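(* Let $F=\mathbb{F}_q$ be the finite field with $q$ elements and let $n\geq 2$. Let $X$ be a conjugacy class in $M_n(F)$ whose characteristic polynomial is irreducible of degree $n$ over $F$, and let $Y$ be a conjugacy class in $M_n(F)$ whose characteristic polynomial is of the form $(T-\lambda)h(T)$, where $\lambda\in F$, $h(T)$ is an irreducible polynomial over $F$ of degree $n-1$, and $h(\lambda)\neq 0$. Let $z\in M_n(F)$ with $\mathrm{Tr}(z)=\mathrm{Tr}(X)+\mathrm{Tr}(Y)$. Then $N_{X,Y}(z)=0$ if $z$ is a scalar matrix, and otherwise $$\left|N_{X,Y}(z)-q^{(n-1)^2}\right|\leq 42\,q^{(n-1)^2-1}.$$
   Context: $q$ is an arbitrary prime power. A conjugacy class in $M_n(F)$ is an orbit of $M_n(F)$ under conjugation by $\mathrm{GL}_n(F)$; its characteristic polynomial and trace $\mathrm{Tr}(X)$ are those of any of its elements. For conjugacy classes $X,Y\subset M_n(F)$ and $z\in M_n(F)$, $N_{X,Y}(z):=\#\{(x,y)\in X\times Y : x+y=z\}$. *)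

theory Defs
  imports "Jordan_Normal_Form.Char_Poly"
begin

definition mat_trace :: "'a :: comm_monoid_add mat \<Rightarrow> 'a" where
  "mat_trace A = (\<Sum>i<dim_row A. A $$ (i, i))"

(* similar_mat B A unfolds to: B = P * A * Q for mutually inverse square matrices P, Q of the
   size of A, so the set below is the orbit of A under conjugation by GL_n. *)
definition conj_class_of :: "'a :: semiring_1 mat \<Rightarrow> 'a mat set" where
  "conj_class_of A = {B. similar_mat B A}"

definition is_conj_class :: "nat \<Rightarrow> 'a :: semiring_1 mat set \<Rightarrow> bool" where
  "is_conj_class n X \<longleftrightarrow> (\<exists>A \<in> carrier_mat n n. X = conj_class_of A)"

(* The images are singletons when X is a conjugacy class: see class_char_poly_eq and
   class_trace_eq. *)
definition class_char_poly :: "'a :: comm_ring_1 mat set \<Rightarrow> 'a poly" where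
  "class_char_poly X = the_elem (char_poly ` X)"

definition class_trace :: "'a :: comm_ring_1 mat set \<Rightarrow> 'a" where
  "class_trace X = the_elem (mat_trace ` X)"

(* Only meaningful for finite X and Y; conjugacy classes over a finite ring are finite, see
   finite_conj_class. *)
definition num_reps :: "'a :: semiring_1 mat set \<Rightarrow> 'a mat set \<Rightarrow> 'a mat \<Rightarrow> nat" where
  "num_reps X Y z = card {(x, y). x \<in> X \<and> y \<in> Y \<and> x + y = z}"

definition is_scalar_mat :: "nat \<Rightarrow> 'a :: semiring_1 mat \<Rightarrow> bool" where
  "is_scalar_mat n A \<longleftrightarrow> (\<exists>c. A = c \<cdot>\<^sub>m 1\<^sub>m n)"

lemma mat_trace_mult_commute:
  fixes A B :: "'a :: comm_ring_1 mat"
  assumes A: "A \<in> carrier_mat n m" and B: "B \<in> carrier_mat m n"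
  shows "mat_trace (A * B) = mat_trace (B * A)"
proof -
  have "mat_trace (A * B) = (\<Sum>i<n. \<Sum>j<m. A $$ (i, j) * B $$ (j, i))"
    using A B by (auto simp: mat_trace_def scalar_prod_def atLeast0LessThan intro!: sum.cong)
  also have "\<dots> = (\<Sum>j<m. \<Sum>i<n. B $$ (j, i) * A $$ (i, j))"
    by (subst sum.swap) (simp add: mult.commute)
  also have "\<dots> = mat_trace (B * A)"
    using A B by (auto simp: mat_trace_def scalar_prod_def atLeast0LessThan intro!: sum.cong)
  finally show ?thesis .
qed

lemma mat_trace_similar:
  fixes A B :: "'a :: comm_ring_1 mat"
  assumes "similar_mat A B"
  shows "mat_trace A = mat_trace B"
proof -
  from similar_matD[OF assms] obtain n P Q where
    c: "A \<in> carrier_mat n n" "B \<in> carrier_mat n n" "P \<in> carrier_mat n n" "Q \<in> carrier_mat n n"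
    and QP: "Q * P = 1\<^sub>m n" and A: "A = P * B * Q" by auto
  have "mat_trace A = mat_trace (Q * (P * B))"
    unfolding A by (rule mat_trace_mult_commute[of _ n n]) (use c in auto)
  also have "Q * (P * B) = (Q * P) * B"
    by (rule assoc_mult_mat[symmetric, of _ n n _ n _ n]) (use c in auto)
  finally show ?thesis using c QP by simp
qed

lemma conj_class_memD:
  assumes "is_conj_class n X" "x \<in> X"
  shows "x \<in> carrier_mat n n" "X = conj_class_of x"
proof -
  from assms obtain A where A: "A \<in> carrier_mat n n" and X: "X = conj_class_of A"
    unfolding is_conj_class_def by auto
  have s: "similar_mat x A" using assms(2) X by (simp add: conj_class_of_def)
  from similar_matD[OF s] A show "x \<in> carrier_mat n n" by auto
  show "X = conj_class_of x"
    unfolding X conj_class_of_def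
    using s similar_mat_sym similar_mat_trans by blast
qed

lemma conj_class_nonempty:
  assumes "is_conj_class n X"
  shows "X \<noteq> {}"
  using assms similar_mat_refl unfolding is_conj_class_def conj_class_of_def by blast

lemma class_char_poly_eq:
  assumes "is_conj_class n X" "x \<in> X"
  shows "class_char_poly X = char_poly x"
proof -
  have "char_poly y = char_poly x" if "y \<in> X" for y
    using that conj_class_memD(2)[OF assms] char_poly_similar by (auto simp: conj_class_of_def)
  then have "char_poly ` X = {char_poly x}" using assms(2) by blast
  then show ?thesis by (simp add: class_char_poly_def)
qed

lemma class_trace_eq:
  assumes "is_conj_class n X" "x \<in> X"
  shows "class_trace X = mat_trace x"
proof -
  have "mat_trace y = mat_trace x" if "y \<in> X" for y
    using that conj_class_memD(2)[OF assms] mat_trace_similar by (auto simp: conj_class_of_def)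
  then have "mat_trace ` X = {mat_trace x}" using assms(2) by blast
  then show ?thesis by (simp add: class_trace_def)
qed

lemma finite_conj_class:
  fixes X :: "'a :: {semiring_1, finite} mat set"
  assumes "is_conj_class n X"
  shows "finite X"
proof (rule finite_subset)
  let ?D = "{..<n} \<times> {..<n}"
  let ?F = "{f :: nat \<times> nat \<Rightarrow> 'a. \<forall>p. (p \<in> ?D \<longrightarrow> f p \<in> UNIV) \<and> (p \<notin> ?D \<longrightarrow> f p = 0)}"
  show "finite (mat n n ` ?F)"
    by (intro finite_imageI finite_set_of_finite_funs) auto
  show "X \<subseteq> mat n n ` ?F"
  proof
    fix x assume "x \<in> X"
    then have x: "x \<in> carrier_mat n n" using conj_class_memD[OF assms] by blast
    have "x = mat n n (\<lambda>p. if p \<in> ?D then x $$ p else 0)"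
      using x by (intro eq_matI) auto
    then show "x \<in> mat n n ` ?F" by (rule image_eqI[of _ "mat n n"]) simp
  qed
qed

end

(* A matrix y in Y has, up to scaling, a unique eigenvector v for lam. If x = z - y, then
   replacing y by y + v r^T with r^T v = 0 keeps y in Y and keeps v as its eigenvector, while by the
   matrix determinant lemma the characteristic polynomials of x - v r^T, when v is a cyclic vector
   of x, run exactly once through all monic polynomials of the right degree and trace. As f, the
   characteristic polynomial of X, is irreducible, every nonzero vector is cyclic for elements of X.
   Hence the pairs (x, y) attached to v are counted, up to the factor q^(n-1), by the y in Y with
   eigenvector v such that v is cyclic for z - y. There are none if v is an eigenvector of z.
   Otherwise, evaluating y successively on the iterates of v under z - y shows that v fails to be
   cyclic only for a proportion O(1/q) of these y, since n - 2 values of y outside Fv determine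
   y up to q possibilities. *)
theory Submission
  imports Defs
begin

section \<open>Vectors under polynomials in a matrix\<close>

text \<open>The sets of y in Y with eigenvector v are bounded individually only from above, by q^(1
  + n(n-2)). Their total over all v is q - 1 times the size of Y and is bounded from below: every
  basis starting with a fixed vector e is the orbit of e under some element of Y, and only a
  proportion O(1/q) of the lists fail to be bases. Both estimates have leading term q^(n^2 - n + 1),
  so little is lost between them. Eigenvectors v of z contribute no pairs, so they must be rare: on
  a line whose direction is not an eigenvector of z at most two points are eigenvectors, which
  leaves at most 2 q^(n-1) of them when z is not scalar. The losses, in units of 1/q of the main
  term, are 1 (lists that are not bases), 2 (v not cyclic for z - y) and 2 (eigenvectors of z).
  Division by q - 1 at most doubles these 5, so an error of 10 q^((n-1)^2 - 1) is reached, within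
  the stated 42. The condition on h(lam) makes a sum of two vectors, one killed by y - lam and one
  by h(y), cyclic for y. Hence Y consists of all matrices with its characteristic polynomial, and
  membership in Y can be tested on that polynomial.\<close>

lemma card_carrier_vec:
  "card (carrier_vec n :: 'a :: finite vec set) = card (UNIV :: 'a set) ^ n"
proof -
  let ?L = "{xs :: 'a list. set xs \<subseteq> UNIV \<and> length xs = n}"
  have "(carrier_vec n :: 'a vec set) = vec_of_list ` ?L"
  proof (intro equalityI subsetI)
    fix v :: "'a vec" assume "v \<in> carrier_vec n"
    then show "v \<in> vec_of_list ` ?L"
      by (intro image_eqI[of _ _ "list_of_vec v"]) (auto simp: vec_list)
  qed (auto intro!: carrier_vecI)
  moreover have "inj_on vec_of_list ?L"
    by (rule inj_on_inverseI[of _ list_of_vec]) (simp add: list_vec)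
  ultimately show ?thesis using card_lists_length_eq[of "UNIV :: 'a set" n] by (simp add: card_image)
qed

lemma finite_carrier_vec [simp]: "finite (carrier_vec n :: 'a :: finite vec set)"
  by (rule card_ge_0_finite) (simp add: card_carrier_vec card_gt_0_iff)

text \<open>The F[T]-module structure in which T acts as \<open>A\<close>, evaluated by Horner's
  scheme so that \<open>act_pCons\<close> is its recursion.\<close>

definition act :: "'a :: field mat \<Rightarrow> 'a poly \<Rightarrow> 'a vec \<Rightarrow> 'a vec" where
  "act A p v = fold_coeffs (\<lambda>a w. a \<cdot>\<^sub>v v + A *\<^sub>v w) p (0\<^sub>v (dim_vec v))"

context
  fixes A :: "'a :: field mat" and n :: nat
  assumes A [simp]: "A \<in> carrier_mat n n"
begin

lemmas [simp] = carrier_matD[OF A]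

lemma mult_mat_vec_closed [simp]: "v \<in> carrier_vec n \<Longrightarrow> A *\<^sub>v v \<in> carrier_vec n"
  by (rule mult_mat_vec_carrier[OF A])

lemma mult_mat_vec_zero [simp]: "A *\<^sub>v 0\<^sub>v n = 0\<^sub>v n"
  using A by (intro eq_vecI) auto

lemma act_0 [simp]: "v \<in> carrier_vec n \<Longrightarrow> act A 0 v = 0\<^sub>v n"
  by (simp add: act_def)

lemma act_pCons [simp]:
  assumes "v \<in> carrier_vec n"
  shows "act A (pCons a p) v = a \<cdot>\<^sub>v v + A *\<^sub>v act A p v"
proof (cases "p = 0 \<and> a = 0")
  case True
  have "0 \<cdot>\<^sub>v v + 0\<^sub>v n = 0\<^sub>v n" using assms by (intro eq_vecI) auto
  then show ?thesis using assms True by simp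
next
  case False
  then show ?thesis using assms
    by (cases "p = 0") (auto simp: act_def fold_coeffs_pCons_not_0_0_eq)
qed

lemma act_closed [simp]: "v \<in> carrier_vec n \<Longrightarrow> act A p v \<in> carrier_vec n"
  by (induction p) (auto)

lemma dim_act [simp]: "v \<in> carrier_vec n \<Longrightarrow> dim_vec (act A p v) = n"
  by (rule carrier_vecD[OF act_closed])

lemma act_1 [simp]: "v \<in> carrier_vec n \<Longrightarrow> act A 1 v = v"
  by (simp add: one_pCons)

lemma mult_add_vec:
  "v \<in> carrier_vec n \<Longrightarrow> w \<in> carrier_vec n \<Longrightarrow> A *\<^sub>v (v + w) = A *\<^sub>v v + A *\<^sub>v w"
  by (rule mult_add_distrib_mat_vec[OF A])

lemma mult_smult_vec: "v \<in> carrier_vec n \<Longrightarrow> A *\<^sub>v (c \<cdot>\<^sub>v v) = c \<cdot>\<^sub>v (A *\<^sub>v v)"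
  by (rule mult_mat_vec[OF A])

lemma act_add:
  assumes v: "v \<in> carrier_vec n"
  shows "act A (p + q) v = act A p v + act A q v"
proof (induction p q rule: poly_induct2)
  case (pCons a p b q)
  have "(a + b) \<cdot>\<^sub>v v + (x + y) = (a \<cdot>\<^sub>v v + x) + (b \<cdot>\<^sub>v v + y)"
    if "x \<in> carrier_vec n" "y \<in> carrier_vec n" for x y
    using that v by (intro eq_vecI) (auto simp: algebra_simps)
  then show ?case using v pCons by (simp add: mult_add_vec)
qed (use v in simp)

lemma act_smult:
  assumes v: "v \<in> carrier_vec n"
  shows "act A (Polynomial.smult c p) v = c \<cdot>\<^sub>v act A p v"
proof (induction p)
  case (pCons a p)
  have "(c * a) \<cdot>\<^sub>v v + c \<cdot>\<^sub>v x = c \<cdot>\<^sub>v (a \<cdot>\<^sub>v v + x)" if "x \<in> carrier_vec n" for x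
    using that v by (intro eq_vecI) (auto simp: algebra_simps)
  then show ?case using v pCons by (simp add: mult_smult_vec)
qed (use v in auto)

lemma act_add_vec:
  assumes v: "v \<in> carrier_vec n" "w \<in> carrier_vec n"
  shows "act A p (v + w) = act A p v + act A p w"
proof (induction p)
  case (pCons a p)
  have "a \<cdot>\<^sub>v (v + w) + (x + y) = (a \<cdot>\<^sub>v v + x) + (a \<cdot>\<^sub>v w + y)"
    if "x \<in> carrier_vec n" "y \<in> carrier_vec n" for x y
    using that v by (intro eq_vecI) (auto simp: algebra_simps)
  then show ?case using v pCons by (simp add: mult_add_vec)
qed (use v in auto)

lemma act_smult_vec:
  assumes v: "v \<in> carrier_vec n"
  shows "act A p (c \<cdot>\<^sub>v v) = c \<cdot>\<^sub>v act A p v"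
proof (induction p)
  case (pCons a p)
  have "a \<cdot>\<^sub>v (c \<cdot>\<^sub>v v) + c \<cdot>\<^sub>v x = c \<cdot>\<^sub>v (a \<cdot>\<^sub>v v + x)" if "x \<in> carrier_vec n" for x
    using that v by (intro eq_vecI) (auto simp: algebra_simps)
  then show ?case using v pCons by (simp add: mult_smult_vec)
qed (use v in auto)

lemma act_mult:
  assumes v: "v \<in> carrier_vec n"
  shows "act A (p * q) v = act A p (act A q v)"
proof (induction p)
  case (pCons a p)
  have "0 \<cdot>\<^sub>v v + x = x" if "x \<in> carrier_vec n" for x
    using that v by (intro eq_vecI) auto
  then show ?case using v pCons
    by (simp add: act_add act_smult)
qed (use v in auto)

lemma act_zero_vec [simp]: "act A p (0\<^sub>v n) = 0\<^sub>v n"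
proof (induction p)
  case (pCons a p)
  have "a \<cdot>\<^sub>v 0\<^sub>v n + 0\<^sub>v n = (0\<^sub>v n :: 'a vec)" by (intro eq_vecI) auto
  then show ?case using pCons by simp
qed auto

lemma act_linear:
  assumes v: "v \<in> carrier_vec n"
  shows "act A [:- l, 1:] v = A *\<^sub>v v - l \<cdot>\<^sub>v v"
proof -
  have "1 \<cdot>\<^sub>v v + 0\<^sub>v n = v" using v by (intro eq_vecI) auto
  moreover have "- l \<cdot>\<^sub>v v + x = x - l \<cdot>\<^sub>v v" if "x \<in> carrier_vec n" for x
    using that v by (intro eq_vecI) auto
  ultimately show ?thesis using v by simp
qed

lemma act_eigenvector:
  assumes v: "v \<in> carrier_vec n" and ev: "A *\<^sub>v v = l \<cdot>\<^sub>v v"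
  shows "act A p v = poly p l \<cdot>\<^sub>v v"
proof (induction p)
  case (pCons a p)
  have "a \<cdot>\<^sub>v v + poly p l \<cdot>\<^sub>v (l \<cdot>\<^sub>v v) = (a + l * poly p l) \<cdot>\<^sub>v v"
    using v by (intro eq_vecI) (auto simp: algebra_simps)
  then show ?case using pCons v by (simp add: mult_smult_vec ev)
next
  case 0
  then show ?case using v by (intro eq_vecI) auto
qed

end

section \<open>Rank one perturbations of the characteristic polynomial\<close>

text \<open>The polynomials \<open>poly_shift k p\<close> are the tails met by Horner's scheme on
  \<open>p\<close>; this is one step of the scheme.\<close>

lemma poly_shift_pCons: "poly_shift k p = pCons (coeff p k) (poly_shift (Suc k) p)"
  by (rule poly_eqI) (simp add: coeff_poly_shift coeff_pCons split: nat.split)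

definition outer :: "'a :: comm_ring_1 vec \<Rightarrow> 'a vec \<Rightarrow> 'a mat" where
  "outer b r = mat (dim_vec b) (dim_vec r) (\<lambda>(i, j). b $ i * r $ j)"

lemma outer_carrier [simp]:
  "b \<in> carrier_vec m \<Longrightarrow> r \<in> carrier_vec n \<Longrightarrow> outer b r \<in> carrier_mat m n"
  by (auto simp: outer_def)

lemma outer_mult_vec:
  assumes "b \<in> carrier_vec m" "r \<in> carrier_vec n" "v \<in> carrier_vec n"
  shows "outer b r *\<^sub>v v = (r \<bullet> v) \<cdot>\<^sub>v b"
  using assms
  by (intro eq_vecI) (auto simp: outer_def scalar_prod_def sum_distrib_left mult_ac intro!: sum.cong)

lemma mat_trace_outer:
  assumes "b \<in> carrier_vec n" "r \<in> carrier_vec n"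
  shows "mat_trace (outer b r) = r \<bullet> b"
  using assms
  by (auto simp: mat_trace_def outer_def scalar_prod_def mult_ac atLeast0LessThan intro!: sum.cong)

text \<open>The matrix determinant lemma \<open>det (M + b r\<^sup>T) = det M + r\<^sup>T adj(M) b\<close>, with
  \<open>adj(M) b\<close> replaced by any solution of \<open>M w = det M b\<close>.\<close>
lemma det_add_outer:
  fixes M :: "'a :: idom mat"
  assumes M: "M \<in> carrier_mat n n" and vs: "b \<in> carrier_vec n" "r \<in> carrier_vec n" "w \<in> carrier_vec n"
    and w: "M *\<^sub>v w = det M \<cdot>\<^sub>v b" and nz: "det M \<noteq> 0"
  shows "det (M + outer b r) = det M + r \<bullet> w"
proof -
  define B where "B = mat n 1 (\<lambda>(i, j). b $ i)"
  define R where "R = mat 1 n (\<lambda>(i, j). - r $ j)"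
  define R' where "R' = mat 1 n (\<lambda>(i, j). r $ j)"
  define W where "W = mat n 1 (\<lambda>(i, j). - w $ i)"
  define D where "D = mat 1 1 (\<lambda>_. det M)"
  define RW where "RW = mat 1 1 (\<lambda>_. det M + r \<bullet> w)"
  have c: "B \<in> carrier_mat n 1" "R \<in> carrier_mat 1 n" "R' \<in> carrier_mat 1 n" "W \<in> carrier_mat n 1"
    "D \<in> carrier_mat 1 1" "RW \<in> carrier_mat 1 1"
    by (auto simp: B_def R_def R'_def W_def D_def RW_def)
  \<comment> \<open>Two block triangular multipliers clear different corners of the bordered matrix:
    one clears the lower left and leaves M + b r^T, the other uses the equation for \<open>w\<close>
    to clear the upper right and leaves M and det M + r.w. The second contributes a factor
    \<open>det M\<close>, cancelled at the end.\<close>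
  let ?L = "four_block_mat M B R (1\<^sub>m 1)"
  have L: "?L \<in> carrier_mat (n + 1) (n + 1)" using M by auto
  have d1: "det N = N $$ (0, 0)" if "N \<in> carrier_mat 1 1" for N :: "'a mat"
    using det_single[of N] that by auto
  have "?L * four_block_mat (1\<^sub>m n) (0\<^sub>m n 1) R' (1\<^sub>m 1) = four_block_mat (M + outer b r) B (0\<^sub>m 1 n) (1\<^sub>m 1)"
    by (subst mult_four_block_mat[of _ n n _ 1 _ 1 _ _ n _ 1], insert M c vs, auto intro!: cong_four_block_mat)
       (auto intro!: eq_matI simp: B_def R_def R'_def outer_def scalar_prod_def)
  then have "det ?L * det (four_block_mat (1\<^sub>m n) (0\<^sub>m n 1) R' (1\<^sub>m 1))
      = det (four_block_mat (M + outer b r) B (0\<^sub>m 1 n) (1\<^sub>m 1))"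
    by (subst det_mult[symmetric]) (use L c in auto)
  moreover have "det (four_block_mat (1\<^sub>m n) (0\<^sub>m n 1) R' (1\<^sub>m 1)) = 1"
    by (subst det_four_block_mat_upper_right_zero) (use c in auto)
  moreover have "det (four_block_mat (M + outer b r) B (0\<^sub>m 1 n) (1\<^sub>m 1)) = det (M + outer b r)"
    by (subst det_four_block_mat_lower_left_zero[where m = 1 and n = n]) (use c vs M in auto)
  ultimately have 1: "det ?L = det (M + outer b r)" by simp
  have mw: "(\<Sum>j = 0..<n. M $$ (i, j) * w $ j) = det M * b $ i" if "i < n" for i
    using arg_cong[OF w, of "\<lambda>v. v $ i"] that M vs by (auto simp: scalar_prod_def)
  have "?L * four_block_mat (1\<^sub>m n) W (0\<^sub>m 1 n) D = four_block_mat M (0\<^sub>m n 1) R RW"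
    by (subst mult_four_block_mat[of _ n n _ 1 _ 1 _ _ n _ 1], insert M c vs, auto intro!: cong_four_block_mat)
       (auto intro!: eq_matI simp: B_def R_def W_def D_def RW_def scalar_prod_def sum_negf mw)
  then have "det ?L * det (four_block_mat (1\<^sub>m n) W (0\<^sub>m 1 n) D) = det (four_block_mat M (0\<^sub>m n 1) R RW)"
    by (subst det_mult[symmetric]) (use L c in auto)
  moreover have "det (four_block_mat (1\<^sub>m n) W (0\<^sub>m 1 n) D) = det M"
    by (subst det_four_block_mat_lower_left_zero[where m = 1 and n = n])
       (use c M in \<open>auto simp: d1 D_def\<close>)
  moreover have "det (four_block_mat M (0\<^sub>m n 1) R RW) = det M * (det M + r \<bullet> w)"
    by (subst det_four_block_mat_upper_right_zero[where m = 1 and n = n])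
       (use c M in \<open>auto simp: d1 RW_def\<close>)
  ultimately show ?thesis using nz 1 by simp
qed

text \<open>Comparing coefficients in (T - A) w = chi b for w = adj(T - A) b gives w_k = A w_(k+1) +
  chi_(k+1) b. This is the Horner recursion for the tails of chi applied to b, and both sides vanish
  for large k. The constant coefficient continues the recursion by one step and yields
  Cayley-Hamilton.\<close>

lemma adj_char_poly_matrix_coeffs:
  fixes A :: "'a :: field mat"
  assumes A: "A \<in> carrier_mat n n" and b: "b \<in> carrier_vec n"
  obtains w where "w \<in> carrier_vec n"
    "char_poly_matrix A *\<^sub>v w = char_poly A \<cdot>\<^sub>v map_vec (\<lambda>a. [:a:]) b"
    "\<And>k. vec n (\<lambda>i. coeff (w $ i) k) = act A (poly_shift (Suc k) (char_poly A)) b"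
    "act A (char_poly A) b = 0\<^sub>v n"
proof -
  let ?chi = "char_poly A" and ?M = "char_poly_matrix A" and ?b = "map_vec (\<lambda>a. [:a:]) b"
  define w where "w = adj_mat ?M *\<^sub>v ?b"
  have M: "?M \<in> carrier_mat n n" using A by simp
  note adj = adj_mat[OF M]
  have wc: "w \<in> carrier_vec n" unfolding w_def using adj(1) b by auto
  have Mw: "?M *\<^sub>v w = ?chi \<cdot>\<^sub>v ?b"
  proof -
    have "?M *\<^sub>v w = (?M * adj_mat ?M) *\<^sub>v ?b"
      unfolding w_def by (rule assoc_mult_mat_vec[symmetric]) (use M adj b in auto)
    also have "\<dots> = ?chi \<cdot>\<^sub>v ?b"
      unfolding adj(2) char_poly_def[symmetric]
      using b by (intro eq_vecI) (auto simp: smult_scalar_prod_distrib[of _ n])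
    finally show ?thesis .
  qed
  define W where "W k = vec n (\<lambda>i. coeff (w $ i) k)" for k
  have Wc [simp]: "W k \<in> carrier_vec n" for k by (simp add: W_def)
  have key: "pCons 0 (w $ i) - (\<Sum>j<n. Polynomial.smult (A $$ (i, j)) (w $ j)) = Polynomial.smult (b $ i) ?chi"
    if i: "i < n" for i
  proof -
    have "(?M *\<^sub>v w) $ i = (\<Sum>j<n. (if i = j then [:0, 1:] else 0) * w $ j + [:- A $$ (i, j):] * w $ j)"
      using i A wc by (auto simp: char_poly_matrix_def scalar_prod_def atLeast0LessThan distrib_right intro!: sum.cong)
    also have "\<dots> = (\<Sum>j<n. (if i = j then pCons 0 (w $ i) else 0)) - (\<Sum>j<n. Polynomial.smult (A $$ (i, j)) (w $ j))"
      unfolding sum.distrib sum_subtractf[symmetric]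
      by (subst sum.distrib[symmetric], intro sum.cong) auto
    finally show ?thesis unfolding Mw using i b by (simp add: mult.commute)
  qed
  have rec: "W k = A *\<^sub>v W (Suc k) + coeff ?chi (Suc k) \<cdot>\<^sub>v b" for k
  proof (intro eq_vecI)
    fix i assume "i < dim_vec (A *\<^sub>v W (Suc k) + coeff ?chi (Suc k) \<cdot>\<^sub>v b)"
    then have i: "i < n" using b by simp
    show "W k $ i = (A *\<^sub>v W (Suc k) + coeff ?chi (Suc k) \<cdot>\<^sub>v b) $ i"
      using arg_cong[OF key[OF i], of "\<lambda>p. coeff p (Suc k)"] i A b
      by (simp add: W_def scalar_prod_def coeff_sum atLeast0LessThan algebra_simps)
  qed (use A b in auto)
  have rec0: "0\<^sub>v n = A *\<^sub>v W 0 + coeff ?chi 0 \<cdot>\<^sub>v b"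
  proof (intro eq_vecI)
    fix i assume "i < dim_vec (A *\<^sub>v W 0 + coeff ?chi 0 \<cdot>\<^sub>v b)"
    then have i: "i < n" using b by simp
    show "0\<^sub>v n $ i = (A *\<^sub>v W 0 + coeff ?chi 0 \<cdot>\<^sub>v b) $ i"
      using arg_cong[OF key[OF i], of "\<lambda>p. coeff p 0"] i A b
      by (simp add: W_def scalar_prod_def coeff_sum atLeast0LessThan algebra_simps,
          metis add.left_inverse)
  qed (use A b in auto)
  \<comment> \<open>A crude index beyond which all coefficients of chi and of the entries of
    \<open>w\<close> vanish, where the downward induction starts.\<close>
  define K where "K = Suc (degree ?chi) + (\<Sum>i<n. Suc (degree (w $ i)))"
  have K: "W k = act A (poly_shift (Suc k) ?chi) b" if "k \<ge> K" for k
  proof -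
    have "coeff (w $ i) k = 0" if "i < n" for i
    proof (rule coeff_eq_0)
      have "Suc (degree (w $ i)) \<le> (\<Sum>i<n. Suc (degree (w $ i)))"
        by (rule member_le_sum) (use that in auto)
      then show "degree (w $ i) < k" using \<open>k \<ge> K\<close> by (simp add: K_def)
    qed
    then have "W k = 0\<^sub>v n" by (intro eq_vecI) (auto simp: W_def)
    moreover have "poly_shift (Suc k) ?chi = 0"
      using \<open>k \<ge> K\<close> by (intro poly_eqI) (simp add: coeff_poly_shift K_def coeff_eq_0)
    ultimately show ?thesis using A b by simp
  qed
  have WS: "W k = act A (poly_shift (Suc k) ?chi) b" for k
  proof (cases "k \<ge> K")
    case False
    then have "k \<le> K" by simp
    then show ?thesis
    proof (induction k rule: inc_induct)
      case (step k)
      show ?case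
        by (subst poly_shift_pCons, subst rec, subst step.IH)
           (simp add: act_pCons[OF A b] comm_add_vec[of _ n] A b mult_mat_vec_closed[OF A] act_closed[OF A])
    qed (use K in simp)
  qed (use K in simp)
  have "act A ?chi b = act A (poly_shift 0 ?chi) b" by (simp add: poly_shift_0)
  also have "\<dots> = 0\<^sub>v n"
    by (subst poly_shift_pCons, subst rec0, subst WS)
      (simp add: act_pCons[OF A b] comm_add_vec[of _ n] A b mult_mat_vec_closed[OF A] act_closed[OF A])
  finally show ?thesis using that[OF wc Mw] WS unfolding W_def by blast
qed

lemma cayley_hamilton_vec:
  fixes A :: "'a :: field mat"
  assumes A: "A \<in> carrier_mat n n" and b: "b \<in> carrier_vec n"
  shows "act A (char_poly A) b = 0\<^sub>v n"
  by (rule adj_char_poly_matrix_coeffs[OF A b])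

text \<open>T - (A - b r^T) is the rank one update (T - A) + b r^T. The point is that each
  coefficient is affine in \<open>r\<close>, with linear part the pairing of \<open>r\<close> with a
  Horner tail applied to \<open>b\<close>.\<close>

lemma coeff_char_poly_minus_outer:
  fixes A :: "'a :: field mat"
  assumes A: "A \<in> carrier_mat n n" and b: "b \<in> carrier_vec n" and r: "r \<in> carrier_vec n"
  shows "coeff (char_poly (A - outer b r)) k
    = coeff (char_poly A) k + r \<bullet> act A (poly_shift (Suc k) (char_poly A)) b"
proof -
  from adj_char_poly_matrix_coeffs[OF A b] obtain w where
    w: "w \<in> carrier_vec n" "char_poly_matrix A *\<^sub>v w = char_poly A \<cdot>\<^sub>v map_vec (\<lambda>a. [:a:]) b"
    "\<And>k. vec n (\<lambda>i. coeff (w $ i) k) = act A (poly_shift (Suc k) (char_poly A)) b"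
    by blast
  let ?b = "map_vec (\<lambda>a. [:a:]) b" and ?r = "map_vec (\<lambda>a. [:a:]) r"
  have "char_poly A \<noteq> 0" using degree_monic_char_poly[OF A] by auto
  moreover have "char_poly_matrix (A - outer b r) = char_poly_matrix A + outer ?b ?r"
    using A b r by (intro eq_matI) (auto simp: char_poly_matrix_def outer_def)
  ultimately have "char_poly (A - outer b r) = char_poly A + ?r \<bullet> w"
    using det_add_outer[of "char_poly_matrix A" n ?b ?r w] A b r w unfolding char_poly_def by auto
  moreover have "coeff (?r \<bullet> w) k = r \<bullet> vec n (\<lambda>i. coeff (w $ i) k)"
    using r w(1) by (simp add: scalar_prod_def coeff_sum)
  ultimately show ?thesis using w(3) by simp
qed

text \<open>The n tails of the monic polynomial chi have degrees n-1, ..., 0, so applied to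
  \<open>b\<close> they span the whole Krylov space of \<open>b\<close>. The proof uses that the
  hypothesis passes from r to A^T r, hence the induction on \<open>p\<close> with \<open>r\<close>
  arbitrary.\<close>

lemma scalar_act_eq_0:
  fixes A :: "'a :: field mat"
  assumes A: "A \<in> carrier_mat n n" and b: "b \<in> carrier_vec n"
    and "r \<in> carrier_vec n" "\<And>k. r \<bullet> act A (poly_shift (Suc k) (char_poly A)) b = 0"
  shows "r \<bullet> act A p b = 0"
  using assms(3,4)
proof (induction p arbitrary: r)
  case 0
  then show ?case using A b by simp
next
  case (pCons a p)
  let ?chi = "char_poly A" and ?s = "transpose_mat A *\<^sub>v r"
  let ?W = "\<lambda>k. act A (poly_shift k ?chi) b"
  have s: "?s \<in> carrier_vec n" using A pCons.prems by auto
  have W: "?W k = coeff ?chi k \<cdot>\<^sub>v b + A *\<^sub>v ?W (Suc k)" for k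
    by (subst poly_shift_pCons) (use A b in simp)
  have rA: "?s \<bullet> x = r \<bullet> (A *\<^sub>v x)" if "x \<in> carrier_vec n" for x
    using transpose_vec_mult_scalar[OF A that pCons.prems(1)] .
  note [simp] = A b pCons.prems(1)
  have rb: "r \<bullet> b = 0"
  proof (cases n)
    case 0
    then show ?thesis using b by (simp add: scalar_prod_def)
  next
    case (Suc m)
    \<comment> \<open>Only the leading coefficient survives a shift by n = \<open>Suc m\<close>, and
      chi is monic; this tail returns \<open>b\<close> itself.\<close>
    have "poly_shift (Suc m) ?chi = 1"
    proof (rule poly_eqI)
      fix i show "coeff (poly_shift (Suc m) ?chi) i = coeff 1 i"
        using degree_monic_char_poly[OF A] Suc
        by (cases i) (auto simp: coeff_poly_shift coeff_eq_0)
    qed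
    then show ?thesis using pCons.prems(2)[of m] act_1[OF A b] by simp
  qed
  have "r \<bullet> ?W k = 0" for k
    by (cases k) (use pCons.prems(2) cayley_hamilton_vec[OF A b] in \<open>auto simp: poly_shift_0\<close>)
  then have "?s \<bullet> ?W (Suc k) = 0" for k
    using arg_cong[OF W[of k], of "\<lambda>v. r \<bullet> v"] rb
    by (simp add: rA scalar_prod_add_distrib[of _ n] scalar_prod_smult_distrib[OF pCons.prems(1) b]
        mult_mat_vec_closed[OF A])
  from pCons.IH[OF s this] show ?case
    using rb act_pCons[OF A b, of a p]
    by (simp add: rA scalar_prod_add_distrib[of _ n] scalar_prod_smult_distrib[OF pCons.prems(1) b]
        mult_mat_vec_closed[OF A])
qed

text \<open>The uniqueness half of the perturbation argument: for cyclic \<open>b\<close> the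
  conclusion forces r = 0. For general \<open>b\<close> it restricts \<open>r\<close> to the
  annihilator of a Krylov space.\<close>

lemma scalar_act_eq_0_if_char_poly_eq:
  fixes A :: "'a :: field mat"
  assumes A: "A \<in> carrier_mat n n" and b: "b \<in> carrier_vec n" and r: "r \<in> carrier_vec n"
    and eq: "char_poly (A - outer b r) = char_poly A"
  shows "r \<bullet> act A p b = 0"
proof (rule scalar_act_eq_0[OF A b r])
  fix k show "r \<bullet> act A (poly_shift (Suc k) (char_poly A)) b = 0"
    using coeff_char_poly_minus_outer[OF A b r, of k] eq by simp
qed

section \<open>Cyclic vectors\<close>

lemma char_poly_nonzero [simp]:
  fixes A :: "'a :: field mat"
  assumes "A \<in> carrier_mat n n"
  shows "char_poly A \<noteq> 0"
  using degree_monic_char_poly[OF assms] by auto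

lemma eq_mat_if_mult_vec_eq:
  fixes M N :: "'a :: comm_ring_1 mat"
  assumes "M \<in> carrier_mat m n" "N \<in> carrier_mat m n"
    and eq: "\<And>v. v \<in> carrier_vec n \<Longrightarrow> M *\<^sub>v v = N *\<^sub>v v"
  shows "M = N"
proof (rule eq_matI)
  fix i j assume "i < dim_row N" "j < dim_col N"
  then show "M $$ (i, j) = N $$ (i, j)"
    using assms(1,2) arg_cong[OF eq[of "unit_vec n j"], of "\<lambda>v. v $ i"] by auto
qed (use assms in auto)

lemma det_nonzero_inverse:
  fixes M :: "'a :: field mat"
  assumes M: "M \<in> carrier_mat n n" and det: "det M \<noteq> 0"
  obtains M' where "M' \<in> carrier_mat n n" "M * M' = 1\<^sub>m n" "M' * M = 1\<^sub>m n"
proof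
  let ?I = "(1 / det M) \<cdot>\<^sub>m adj_mat M"
  note adj = adj_mat[OF M]
  show "?I \<in> carrier_mat n n" using adj(1) by simp
  show "M * ?I = 1\<^sub>m n"
    using det by (subst mult_smult_distrib[OF M adj(1)], subst adj(2)) (intro eq_matI, auto)
  show "?I * M = 1\<^sub>m n"
    using det by (subst mult_smult_assoc_mat[OF adj(1) M], subst adj(3)) (intro eq_matI, auto)
qed

definition poly_of :: "nat \<Rightarrow> 'a :: field vec \<Rightarrow> 'a poly" where
  "poly_of n a = (\<Sum>j<n. monom (a $ j) j)"

lemma coeff_poly_of: "coeff (poly_of n a) k = (if k < n then a $ k else 0)"
  by (auto simp: poly_of_def coeff_sum if_distrib cong: if_cong)

lemma degree_poly_of: "poly_of n a = 0 \<or> degree (poly_of n a) < n"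
proof (cases "poly_of n a = 0")
  case False
  then have "coeff (poly_of n a) (degree (poly_of n a)) \<noteq> 0" by simp
  then show ?thesis by (auto simp: coeff_poly_of split: if_splits)
qed simp

lemma poly_of_coeffs:
  assumes "p = 0 \<or> degree p < n"
  shows "poly_of n (vec n (coeff p)) = p"
  using assms by (intro poly_eqI) (auto simp: coeff_poly_of coeff_eq_0)

text \<open>Stated through annihilators rather than spans: for c in F^n it says that c, Ac, ...,
  A^(n-1) c are independent, hence a basis.\<close>

definition cyclic_vec :: "'a :: field mat \<Rightarrow> 'a vec \<Rightarrow> bool" where
  "cyclic_vec A c \<longleftrightarrow>
    (\<forall>p. act A p c = 0\<^sub>v (dim_vec c) \<longrightarrow> p = 0 \<or> dim_vec c \<le> degree p)"

definition krylov_mat :: "'a :: field mat \<Rightarrow> 'a vec \<Rightarrow> 'a mat" where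
  "krylov_mat A c = mat (dim_vec c) (dim_vec c) (\<lambda>(i, j). act A (monom 1 j) c $ i)"

context
  fixes A :: "'a :: field mat" and n :: nat and c :: "'a vec"
  assumes A: "A \<in> carrier_mat n n" and c: "c \<in> carrier_vec n"
begin

lemma act_diff: "act A (p - q) c = act A p c - act A q c"
proof -
  have "p - q = p + Polynomial.smult (- 1) q" by simp
  then have "act A (p - q) c = act A p c + (- 1) \<cdot>\<^sub>v act A q c"
    by (simp only: act_add[OF A c] act_smult[OF A c])
  also have "\<dots> = act A p c - act A q c"
    using act_closed[OF A c] by (intro eq_vecI) (auto simp: dim_act[OF A c])
  finally show ?thesis .
qed

lemma act_sum_index:
  assumes "i < n"
  shows "act A (sum f S) c $ i = (\<Sum>s\<in>S. act A (f s) c $ i)"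
proof (induction S rule: infinite_finite_induct)
  case (insert x S)
  then show ?case using assms by (simp add: act_add[OF A c] dim_act[OF A c])
qed (use assms act_0[OF A c] in auto)

lemma act_mod_char_poly: "act A (p mod char_poly A) c = act A p c"
proof -
  have "act A p c = act A (p div char_poly A * char_poly A + p mod char_poly A) c" by simp
  also have "\<dots> = act A (p div char_poly A) (act A (char_poly A) c) + act A (p mod char_poly A) c"
    by (simp only: act_add[OF A c] act_mult[OF A c])
  also have "\<dots> = act A (p mod char_poly A) c"
    using act_closed[OF A c] by (simp add: cayley_hamilton_vec[OF A c] act_zero_vec[OF A])
  finally show ?thesis by simp
qed

lemma cyclic_vec_iff: "cyclic_vec A c \<longleftrightarrow> (\<forall>p. act A p c = 0\<^sub>v n \<longrightarrow> p = 0 \<or> n \<le> degree p)"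
  using c by (simp add: cyclic_vec_def)

lemma krylov_mat_carrier [simp]: "krylov_mat A c \<in> carrier_mat n n"
  using c by (simp add: krylov_mat_def)

lemma krylov_mat_mult:
  assumes a: "a \<in> carrier_vec n"
  shows "krylov_mat A c *\<^sub>v a = act A (poly_of n a) c"
proof (intro eq_vecI)
  fix i assume "i < dim_vec (act A (poly_of n a) c)"
  then have i: "i < n" using dim_act[OF A c] by simp
  have "act A (monom (a $ j) j) c $ i = act A (monom 1 j) c $ i * a $ j" for j
    using arg_cong[OF act_smult[OF A c, of "a $ j" "monom 1 j"], of "\<lambda>v. v $ i"] i
    by (simp add: smult_monom dim_act[OF A c] mult.commute)
  moreover have "(krylov_mat A c *\<^sub>v a) $ i = (\<Sum>j<n. act A (monom 1 j) c $ i * a $ j)"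
    using i a c by (simp add: krylov_mat_def scalar_prod_def atLeast0LessThan)
  ultimately show "(krylov_mat A c *\<^sub>v a) $ i = act A (poly_of n a) c $ i"
    unfolding poly_of_def act_sum_index[OF i] by (simp only:)
qed (use c in \<open>simp add: krylov_mat_def dim_act[OF A c]\<close>)

text \<open>In the Krylov basis \<open>A\<close> is multiplication by T modulo its characteristic
  polynomial, a companion matrix in which nothing else of \<open>A\<close> is visible.\<close>

lemma mult_krylov_mat:
  assumes a: "a \<in> carrier_vec n"
  shows "A *\<^sub>v (krylov_mat A c *\<^sub>v a)
    = krylov_mat A c *\<^sub>v vec n (coeff (([:0, 1:] * poly_of n a) mod char_poly A))"
proof -
  let ?p = "([:0, 1:] * poly_of n a) mod char_poly A"
  have "A *\<^sub>v (krylov_mat A c *\<^sub>v a) = act A ([:0, 1:] * poly_of n a) c"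
  proof -
    have "act A ([:0, 1:] * poly_of n a) c = 0 \<cdot>\<^sub>v c + A *\<^sub>v act A (poly_of n a) c"
      using act_pCons[OF A c, of 0 "poly_of n a"] by simp
    also have "\<dots> = A *\<^sub>v act A (poly_of n a) c"
      using c mult_mat_vec_closed[OF A act_closed[OF A c]] by (intro eq_vecI) (auto simp: carrier_matD[OF A])
    finally show ?thesis using a by (simp add: krylov_mat_mult)
  qed
  also have "\<dots> = act A ?p c" by (rule act_mod_char_poly[symmetric])
  also have "\<dots> = act A (poly_of n (vec n (coeff ?p))) c"
    using degree_mod_less[OF char_poly_nonzero[OF A], of "[:0, 1:] * poly_of n a"]
      degree_monic_char_poly[OF A] by (subst poly_of_coeffs) auto
  also have "\<dots> = krylov_mat A c *\<^sub>v vec n (coeff ?p)" by (simp add: krylov_mat_mult)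
  finally show ?thesis .
qed

lemma det_krylov_mat:
  assumes "cyclic_vec A c"
  shows "det (krylov_mat A c) \<noteq> 0"
proof
  assume "det (krylov_mat A c) = 0"
  then obtain a where a: "a \<in> carrier_vec n" "a \<noteq> 0\<^sub>v n" "krylov_mat A c *\<^sub>v a = 0\<^sub>v n"
    using det_0_iff_vec_prod_zero_field[OF krylov_mat_carrier] by blast
  then have "poly_of n a = 0 \<or> n \<le> degree (poly_of n a)"
    using assms by (simp add: cyclic_vec_iff krylov_mat_mult)
  then have "poly_of n a = 0" using degree_poly_of[of n a] by linarith
  then have "a $ k = 0" if "k < n" for k using coeff_poly_of[of n a k] that by simp
  then show False using a by (auto intro!: eq_vecI)
qed

lemma act_surj:
  assumes "cyclic_vec A c" and v: "v \<in> carrier_vec n"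
  obtains p where "act A p c = v"
proof -
  let ?K = "krylov_mat A c"
  obtain K' where K': "K' \<in> carrier_mat n n" "?K * K' = 1\<^sub>m n"
    using det_nonzero_inverse[OF krylov_mat_carrier det_krylov_mat[OF assms(1)]] by blast
  have "act A (poly_of n (K' *\<^sub>v v)) c = ?K *\<^sub>v (K' *\<^sub>v v)"
    using K' v by (subst krylov_mat_mult) auto
  also have "\<dots> = (?K * K') *\<^sub>v v"
    by (rule assoc_mult_mat_vec[symmetric]) (use K' v in auto)
  also have "\<dots> = v" using K' v by simp
  finally show ?thesis by (rule that)
qed

text \<open>The annihilator of \<open>c\<close> is a principal ideal containing \<open>f\<close>.
  Its generator divides \<open>f\<close>, so it is a unit, which would give c = 0, or an associate
  of \<open>f\<close>.\<close>

lemma irreducible_annihilator_dvd: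
  assumes "irreducible f" "act A f c = 0\<^sub>v n" "c \<noteq> 0\<^sub>v n" "act A p c = 0\<^sub>v n"
  shows "f dvd p"
proof -
  \<comment> \<open>An element of least degree in \<open>S\<close> generates the annihilator, by
    division with remainder.\<close>
  define S where "S = {m. m \<noteq> 0 \<and> act A m c = 0\<^sub>v n}"
  have "f \<in> S" using assms by (auto simp: S_def)
  then obtain m where m: "m \<in> S" "\<And>k. k \<in> S \<Longrightarrow> degree m \<le> degree k"
    using ex_has_least_nat[of "\<lambda>m. m \<in> S" f degree] by blast
  have dvd: "m dvd k" if "act A k c = 0\<^sub>v n" for k
  proof (rule ccontr)
    assume "\<not> m dvd k"
    then have nz: "k mod m \<noteq> 0" by (simp add: dvd_eq_mod_eq_0)
    have "act A (k mod m) c = act A (k - k div m * m) c" by (simp add: minus_div_mult_eq_mod)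
    also have "\<dots> = act A k c - act A (k div m) (act A m c)"
      by (simp only: act_diff act_mult[OF A c])
    also have "\<dots> = 0\<^sub>v n" using m that by (simp add: S_def act_zero_vec[OF A])
    finally have "k mod m \<in> S" using nz by (simp add: S_def)
    then have "degree m \<le> degree (k mod m)" by (rule m(2))
    then show False using degree_mod_less[of m k] m(1) nz by (auto simp: S_def)
  qed
  from dvd[OF assms(2)] obtain k where k: "f = m * k" by (auto simp: dvd_def)
  then have "is_unit m \<or> is_unit k" using irreducibleD[OF assms(1)] by blast
  then show ?thesis
  proof
    assume "is_unit m"
    then have "degree m = 0" by (simp add: is_unit_iff_degree)
    then obtain a where "m = [:a:]" by (rule degree_eq_zeroE)
    with m(1) have a: "m = [:a:]" "a \<noteq> 0" by (auto simp: S_def)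
    have "act A m c = a \<cdot>\<^sub>v c"
      unfolding a using c act_pCons[OF A c] act_0[OF A c] mult_mat_vec_zero[OF A] by simp
    then have "a \<cdot>\<^sub>v c = 0\<^sub>v n" using m(1) by (simp add: S_def)
    then have "(a \<cdot>\<^sub>v c) $ i = 0" if "i < n" for i using that by simp
    then have "c $ i = 0" if "i < n" for i using that a c by simp
    then show ?thesis using assms(3) c by (auto intro!: eq_vecI)
  next
    assume "is_unit k"
    then have "f dvd m" by (simp add: k mult_unit_dvd_iff)
    then show ?thesis using dvd[OF assms(4)] dvd_trans by blast
  qed
qed

lemma cyclic_vec_if_irreducible:
  assumes "irreducible (char_poly A)" "c \<noteq> 0\<^sub>v n"
  shows "cyclic_vec A c"
  unfolding cyclic_vec_iff
proof (intro allI impI)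
  fix p assume "act A p c = 0\<^sub>v n"
  then have "char_poly A dvd p"
    by (rule irreducible_annihilator_dvd[OF assms(1) cayley_hamilton_vec[OF A c] assms(2)])
  then show "p = 0 \<or> n \<le> degree p"
    using dvd_imp_degree_le[of "char_poly A" p] degree_monic_char_poly[OF A] by auto
qed

end

text \<open>In their Krylov bases both matrices become the companion matrix of the common
  characteristic polynomial.\<close>

lemma similar_if_cyclic:
  fixes A B :: "'a :: field mat"
  assumes A: "A \<in> carrier_mat n n" "c \<in> carrier_vec n" "cyclic_vec A c"
    and B: "B \<in> carrier_mat n n" "d \<in> carrier_vec n" "cyclic_vec B d"
    and eq: "char_poly A = char_poly B"
  shows "similar_mat A B"
proof -
  define K L where "K = krylov_mat A c" and "L = krylov_mat B d"
  have KL [simp]: "K \<in> carrier_mat n n" "L \<in> carrier_mat n n"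
    using A B by (simp_all add: K_def L_def)
  obtain K' where K': "K' \<in> carrier_mat n n" "K * K' = 1\<^sub>m n" "K' * K = 1\<^sub>m n"
    using det_nonzero_inverse[OF KL(1)] det_krylov_mat[OF A] unfolding K_def by blast
  obtain L' where L': "L' \<in> carrier_mat n n" "L * L' = 1\<^sub>m n" "L' * L = 1\<^sub>m n"
    using det_nonzero_inverse[OF KL(2)] det_krylov_mat[OF B] unfolding L_def by blast
  note cs = A(1) B(1) KL K'(1) L'(1)
  note assoc = assoc_mult_mat[of _ n n _ n _ n]
  have "(L' * B) * L = (K' * A) * K"
  proof (rule eq_mat_if_mult_vec_eq[of _ n n])
    fix v :: "'a vec" assume v: "v \<in> carrier_vec n"
    define s where "s = vec n (coeff (([:0, 1:] * poly_of n v) mod char_poly A))"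
    have s: "s \<in> carrier_vec n" by (simp add: s_def)
    have "(K' * A * K) *\<^sub>v v = K' *\<^sub>v (A *\<^sub>v (K *\<^sub>v v))"
      using cs v by (simp add: assoc_mult_mat_vec[of _ n n _ n])
    also have "A *\<^sub>v (K *\<^sub>v v) = K *\<^sub>v s"
      unfolding K_def s_def by (rule mult_krylov_mat[OF A(1,2) v])
    also have "K' *\<^sub>v (K *\<^sub>v s) = s"
      using K' cs s by (simp add: assoc_mult_mat_vec[of _ n n _ n, symmetric])
    finally have 1: "(K' * A * K) *\<^sub>v v = s" .
    have "(L' * B * L) *\<^sub>v v = L' *\<^sub>v (B *\<^sub>v (L *\<^sub>v v))"
      using cs v by (simp add: assoc_mult_mat_vec[of _ n n _ n])
    also have "B *\<^sub>v (L *\<^sub>v v) = L *\<^sub>v s"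
      unfolding L_def s_def eq by (rule mult_krylov_mat[OF B(1,2) v])
    also have "L' *\<^sub>v (L *\<^sub>v s) = s"
      using L' cs s by (simp add: assoc_mult_mat_vec[of _ n n _ n, symmetric])
    finally show "(L' * B * L) *\<^sub>v v = (K' * A * K) *\<^sub>v v" using 1 by simp
  qed (use cs in auto)
  moreover have "similar_mat (K' * A * K) A"
    by (rule similar_matI[of _ _ K' K n]) (use cs K' in auto)
  moreover have "similar_mat (L' * B * L) B"
    by (rule similar_matI[of _ _ L' L n]) (use cs L' in auto)
  ultimately show ?thesis using similar_mat_sym similar_mat_trans by metis
qed

section \<open>Matrices with characteristic polynomial (T - l) h\<close>

locale linear_times_irreducible =
  fixes y :: "'a :: field mat" and n :: nat and l :: 'a and h :: "'a poly"
  assumes y: "y \<in> carrier_mat n n"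
    and n: "n \<ge> 2"
    and cp: "char_poly y = [:- l, 1:] * h"
    and irr: "irreducible h"
    and hl: "poly h l \<noteq> 0"
begin

lemma exists_eigenvector:
  obtains v where "v \<in> carrier_vec n" "v \<noteq> 0\<^sub>v n" "y *\<^sub>v v = l \<cdot>\<^sub>v v"
proof -
  have "eigenvalue y l" using eigenvalue_root_char_poly[OF y] cp by simp
  then show ?thesis using that y unfolding eigenvalue_def eigenvector_def by auto
qed

lemma act_h_linear:
  assumes "b \<in> carrier_vec n"
  shows "act y h (act y [:- l, 1:] b) = 0\<^sub>v n"
  using cayley_hamilton_vec[OF y assms] by (simp only: cp act_mult[OF y assms, symmetric] mult.commute)

lemma act_swap: "b \<in> carrier_vec n \<Longrightarrow> act y p (act y q b) = act y q (act y p b)"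
  by (simp only: act_mult[OF y, symmetric] mult.commute)

lemma linear_eq_0_iff:
  assumes "b \<in> carrier_vec n"
  shows "act y [:- l, 1:] b = 0\<^sub>v n \<longleftrightarrow> y *\<^sub>v b = l \<cdot>\<^sub>v b"
proof -
  have "w - x = 0\<^sub>v n \<longleftrightarrow> w = x" if "w \<in> carrier_vec n" "x \<in> carrier_vec n" for w x :: "'a vec"
    using that by (auto simp: vec_eq_iff)
  then show ?thesis
    using assms by (simp add: act_linear[OF y] mult_mat_vec_closed[OF y])
qed

text \<open>Otherwise \<open>y\<close> would be scalar and h = (T - l)^(n-1), which vanishes at
  \<open>l\<close> since n >= 2. By \<open>act_h_linear\<close> the resulting (y - l)b is a nonzero
  vector in the kernel of h(y).\<close>

lemma exists_non_eigenvector: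
  obtains b where "b \<in> carrier_vec n" "act y [:- l, 1:] b \<noteq> 0\<^sub>v n"
proof (rule ccontr)
  assume contr: "\<not> thesis"
  note witness = that
  have "y *\<^sub>v b = l \<cdot>\<^sub>v b" if "b \<in> carrier_vec n" for b
    using that linear_eq_0_iff witness contr by blast
  then have "y = l \<cdot>\<^sub>m 1\<^sub>m n"
    using y by (intro eq_mat_if_mult_vec_eq[of _ n n]) (auto intro!: eq_vecI)
  then have "char_poly y = (\<Prod>a\<leftarrow>diag_mat (l \<cdot>\<^sub>m 1\<^sub>m n). [:- a, 1:])"
    by (simp add: char_poly_upper_triangular[of _ n] upper_triangular_def)
  also have "diag_mat (l \<cdot>\<^sub>m 1\<^sub>m n) = replicate n l"
    by (intro nth_equalityI) (auto simp: diag_mat_def)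
  also have "(\<Prod>a\<leftarrow>replicate n l. [:- a, 1:]) = [:- l, 1:] * [:- l, 1:] ^ (n - 1)"
    using n by (cases n) auto
  finally have "[:- l, 1:] * h = [:- l, 1:] * [:- l, 1:] ^ (n - 1)" by (simp only: cp)
  then have "h = [:- l, 1:] ^ (n - 1)" by (simp only: mult_cancel_left) auto
  then show False using hl n by (simp add: poly_power)
qed

lemma annihilator_dvd:
  assumes u: "u \<in> carrier_vec n" "u \<noteq> 0\<^sub>v n" "act y h u = 0\<^sub>v n" and p: "act y p u = 0\<^sub>v n"
  shows "h dvd p"
  by (rule irreducible_annihilator_dvd[OF y u(1) irr u(3) u(2) p])

context
  fixes v :: "'a vec"
  assumes v: "v \<in> carrier_vec n" "v \<noteq> 0\<^sub>v n" "y *\<^sub>v v = l \<cdot>\<^sub>v v"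
begin

lemma act_sum_eq:
  assumes "u \<in> carrier_vec n"
  shows "act y p (v + u) = poly p l \<cdot>\<^sub>v v + act y p u"
  using act_add_vec[OF y v(1) assms] act_eigenvector[OF y v(1,3)] by simp

text \<open>If p kills v + u, applying h(y) removes u and leaves h(l) p(l) v = 0, so p(l) = 0. Then
  p kills u as well, hence h divides p, and as h(l) is nonzero T - l divides the cofactor.\<close>

lemma cyclic_sum:
  assumes u: "u \<in> carrier_vec n" "u \<noteq> 0\<^sub>v n" "act y h u = 0\<^sub>v n"
  shows "cyclic_vec y (v + u)"
proof -
  have vu: "v + u \<in> carrier_vec n" using v u by simp
  have "p = 0 \<or> n \<le> degree p" if p: "act y p (v + u) = 0\<^sub>v n" for p
  proof -
    have "0\<^sub>v n = act y p (act y h (v + u))"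
      using p act_swap[OF vu, of h p] act_zero_vec[OF y] by simp
    also have "act y h (v + u) = poly h l \<cdot>\<^sub>v v"
      using u v by (simp add: act_sum_eq)
    also have "act y p (poly h l \<cdot>\<^sub>v v) = (poly h l * poly p l) \<cdot>\<^sub>v v"
      using v(1) by (simp add: act_smult_vec[OF y] act_eigenvector[OF y v(1,3)] smult_smult_assoc)
    finally have 0: "(poly h l * poly p l) \<cdot>\<^sub>v v = 0\<^sub>v n" by simp
    have pl: "poly p l = 0"
    proof (rule ccontr)
      assume "poly p l \<noteq> 0"
      then have "v $ i = 0" if "i < n" for i
        using arg_cong[OF 0, of "\<lambda>w. w $ i"] hl that v(1) by simp
      then show False using v by (auto intro!: eq_vecI)
    qed
    have "act y p u = 0\<^sub>v n"
    proof (intro eq_vecI)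
      fix i assume "i < dim_vec (0\<^sub>v n :: 'a vec)"
      then show "act y p u $ i = 0\<^sub>v n $ i"
        using arg_cong[OF p, of "\<lambda>w. w $ i"] act_sum_eq[OF u(1), of p] v(1) u(1) pl
        by (simp add: dim_act[OF y])
    qed (use u(1) in \<open>simp add: dim_act[OF y]\<close>)
    then have "h dvd p" by (rule annihilator_dvd[OF u])
    then obtain k where k: "p = h * k" by (auto simp: dvd_def)
    then have "poly k l = 0" using pl hl by simp
    then have "[:- l, 1:] dvd k" by (simp add: poly_eq_0_iff_dvd)
    then have "[:- l, 1:] * h dvd k * h" by (rule mult_dvd_mono) simp
    then have "char_poly y dvd p" by (simp only: cp k mult.commute)
    then show ?thesis
      using dvd_imp_degree_le[of "char_poly y" p] degree_monic_char_poly[OF y] by auto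
  qed
  then show ?thesis using cyclic_vec_iff[OF y vu] by blast
qed

lemma span_sum:
  assumes u: "u \<in> carrier_vec n" "u \<noteq> 0\<^sub>v n" "act y h u = 0\<^sub>v n" and s: "s \<in> carrier_vec n"
  obtains p where "s = poly p l \<cdot>\<^sub>v v + act y p u"
proof -
  have vu: "v + u \<in> carrier_vec n" using v u by simp
  obtain p where "act y p (v + u) = s" by (rule act_surj[OF y vu cyclic_sum[OF u] s])
  then show ?thesis using that[of p] act_sum_eq[OF u(1), of p] by metis
qed

text \<open>Write b = p(l) v + p(y) u using the cyclic vector v + u. Applying h(y) kills the second
  summand and multiplies \<open>b\<close> and \<open>v\<close> by the nonzero h(l).\<close>

lemma eigenvector_unique:
  assumes b: "b \<in> carrier_vec n" "y *\<^sub>v b = l \<cdot>\<^sub>v b"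
  obtains t where "b = t \<cdot>\<^sub>v v"
proof -
  obtain c where c: "c \<in> carrier_vec n" "act y [:- l, 1:] c \<noteq> 0\<^sub>v n"
    by (rule exists_non_eigenvector)
  define u where "u = act y [:- l, 1:] c"
  have u: "u \<in> carrier_vec n" "u \<noteq> 0\<^sub>v n" "act y h u = 0\<^sub>v n"
    using c act_h_linear[OF c(1)] act_closed[OF y c(1)] unfolding u_def by blast+
  obtain p where p: "b = poly p l \<cdot>\<^sub>v v + act y p u" by (rule span_sum[OF u b(1)])
  have "poly h l \<cdot>\<^sub>v b = act y h b" by (rule act_eigenvector[OF y b, symmetric])
  also have "\<dots> = act y h (poly p l \<cdot>\<^sub>v v) + act y h (act y p u)"
    unfolding p using v(1) u(1) by (intro act_add_vec[OF y]) (auto simp: act_closed[OF y])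
  also have "act y h (act y p u) = 0\<^sub>v n"
    using act_swap[OF u(1), of h p] u(3) act_zero_vec[OF y] by simp
  also have "act y h (poly p l \<cdot>\<^sub>v v) = (poly p l * poly h l) \<cdot>\<^sub>v v"
    using v(1) by (simp add: act_smult_vec[OF y] act_eigenvector[OF y v(1,3)] smult_smult_assoc)
  finally have eq: "poly h l \<cdot>\<^sub>v b = (poly p l * poly h l) \<cdot>\<^sub>v v + 0\<^sub>v n" .
  have "b = poly p l \<cdot>\<^sub>v v"
  proof (intro eq_vecI)
    fix i assume "i < dim_vec (poly p l \<cdot>\<^sub>v v)"
    then show "b $ i = (poly p l \<cdot>\<^sub>v v) $ i"
      using arg_cong[OF eq, of "\<lambda>w. w $ i"] v(1) b(1) hl by simp
  qed (use v b in simp)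
  then show ?thesis by (rule that)
qed

text \<open>Off the line of \<open>v\<close>, the vector (y - l)b is nonzero and killed by h(y), so
  it can play the role of \<open>u\<close> in \<open>span_sum\<close>.\<close>

lemma span_eigenvector:
  assumes b: "b \<in> carrier_vec n" "\<And>t. b \<noteq> t \<cdot>\<^sub>v v" and s: "s \<in> carrier_vec n"
  obtains t p where "s = t \<cdot>\<^sub>v v + act y p b"
proof -
  define u where "u = act y [:- l, 1:] b"
  have "u \<noteq> 0\<^sub>v n"
    using eigenvector_unique[OF b(1)] b unfolding u_def linear_eq_0_iff[OF b(1)] by blast
  then have u: "u \<in> carrier_vec n" "u \<noteq> 0\<^sub>v n" "act y h u = 0\<^sub>v n"
    using act_h_linear[OF b(1)] act_closed[OF y b(1)] unfolding u_def by blast+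
  obtain p where "s = poly p l \<cdot>\<^sub>v v + act y p u" by (rule span_sum[OF u s])
  then have "s = poly p l \<cdot>\<^sub>v v + act y (p * [:- l, 1:]) b"
    by (simp only: u_def act_mult[OF y b(1)])
  then show ?thesis by (rule that)
qed

end

lemma exists_basis_vectors:
  obtains v u where "v \<in> carrier_vec n" "v \<noteq> 0\<^sub>v n" "y *\<^sub>v v = l \<cdot>\<^sub>v v"
    "u \<in> carrier_vec n" "u \<noteq> 0\<^sub>v n" "act y h u = 0\<^sub>v n" "cyclic_vec y (v + u)"
proof -
  obtain v where v: "v \<in> carrier_vec n" "v \<noteq> 0\<^sub>v n" "y *\<^sub>v v = l \<cdot>\<^sub>v v"
    by (rule exists_eigenvector)
  obtain c where c: "c \<in> carrier_vec n" "act y [:- l, 1:] c \<noteq> 0\<^sub>v n"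
    by (rule exists_non_eigenvector)
  show ?thesis
    using that[OF v act_closed[OF y c(1)] c(2) act_h_linear[OF c(1)]]
      cyclic_sum[OF v act_closed[OF y c(1)] c(2) act_h_linear[OF c(1)]] by blast
qed

end

section \<open>Spans and linear independence of lists of vectors\<close>

fun span_list :: "nat \<Rightarrow> 'a :: field vec list \<Rightarrow> 'a vec set" where
  "span_list n [] = {0\<^sub>v n}"
| "span_list n (u # us) = (\<lambda>(t, w). t \<cdot>\<^sub>v u + w) ` (UNIV \<times> span_list n us)"

lemma span_list_ConsI: "w \<in> span_list n us \<Longrightarrow> t \<cdot>\<^sub>v u + w \<in> span_list n (u # us)"
  by force

text \<open>Lists grow at the head, and each vector is tested against the span of those already
  present. This is the form in which the lists are counted later.\<close>

fun lin_indep :: "nat \<Rightarrow> 'a :: field vec list \<Rightarrow> bool" where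
  "lin_indep n [] \<longleftrightarrow> True"
| "lin_indep n (u # us) \<longleftrightarrow> u \<in> carrier_vec n \<and> u \<notin> span_list n us \<and> lin_indep n us"

lemma lin_indep_carrier: "lin_indep n us \<Longrightarrow> set us \<subseteq> carrier_vec n"
  by (induction us) auto

lemma span_list_carrier: "set us \<subseteq> carrier_vec n \<Longrightarrow> span_list n us \<subseteq> carrier_vec n"
  by (induction us) auto

lemma span_list_smult:
  assumes "set us \<subseteq> carrier_vec n" "w \<in> span_list n us"
  shows "c \<cdot>\<^sub>v w \<in> span_list n us"
  using assms
proof (induction us arbitrary: w)
  case (Cons u us)
  then obtain t x where w: "w = t \<cdot>\<^sub>v u + x" "x \<in> span_list n us" by auto
  have "x \<in> carrier_vec n" using span_list_carrier[of us n] Cons.prems w by auto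
  then have "c \<cdot>\<^sub>v w = (c * t) \<cdot>\<^sub>v u + c \<cdot>\<^sub>v x"
    unfolding w using Cons.prems by (intro eq_vecI) (auto simp: algebra_simps)
  then show ?case using Cons w by (auto intro!: image_eqI[of _ _ "(c * t, c \<cdot>\<^sub>v x)"])
qed auto

lemma card_span_list:
  fixes us :: "'a :: {field, finite} vec list"
  shows "finite (span_list n us)" "card (span_list n us) \<le> card (UNIV :: 'a set) ^ length us"
proof (induction us)
  case (Cons u us)
  show "finite (span_list n (u # us))" using Cons by simp
  have "card (span_list n (u # us)) \<le> card ((UNIV :: 'a set) \<times> span_list n us)"
    unfolding span_list.simps by (rule card_image_le) (use Cons in simp)
  also have "\<dots> \<le> card (UNIV :: 'a set) ^ length (u # us)"
    using Cons by (simp add: card_cartesian_product)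
  finally show "card (span_list n (u # us)) \<le> card (UNIV :: 'a set) ^ length (u # us)" .
qed auto

lemma card_field_ge_2: "card (UNIV :: 'a :: {field, finite} set) \<ge> 2"
proof -
  have "card {0, 1 :: 'a} \<le> card (UNIV :: 'a set)" by (rule card_mono) auto
  then show ?thesis by simp
qed

lemma exists_not_in_span:
  fixes us :: "'a :: {field, finite} vec list"
  assumes "length us < n"
  obtains w where "w \<in> carrier_vec n" "w \<notin> span_list n us"
proof -
  have "card (UNIV :: 'a set) ^ length us < card (UNIV :: 'a set) ^ n"
    by (rule power_strict_increasing[OF assms]) (use card_field_ge_2[where 'a = 'a] in linarith)
  then have "card (span_list n us) < card (carrier_vec n :: 'a vec set)"
    using card_span_list(2)[of n us] by (simp add: card_carrier_vec)
  then have "\<not> carrier_vec n \<subseteq> span_list n us"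
    using card_mono[OF card_span_list(1)] by (meson leD)
  then show ?thesis using that by blast
qed

lemma mat_of_cols_Cons_mult:
  fixes u :: "'a :: field vec"
  assumes "set (u # us) \<subseteq> carrier_vec n" "a \<in> carrier_vec (Suc (length us))"
  shows "mat_of_cols n (u # us) *\<^sub>v a
    = a $ 0 \<cdot>\<^sub>v u + mat_of_cols n us *\<^sub>v vec (length us) (\<lambda>i. a $ Suc i)"
  using assms
  by (intro eq_vecI)
     (auto simp: scalar_prod_def sum.atLeast0_lessThan_Suc_shift mat_of_cols_Cons_index_0
        mat_of_cols_Cons_index_Suc mat_of_cols_index mult.commute simp del: sum.op_ivl_Suc)

lemma mat_of_cols_mult_in_span:
  assumes "set us \<subseteq> carrier_vec n" "a \<in> carrier_vec (length us)"
  shows "mat_of_cols n us *\<^sub>v a \<in> span_list n us"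
  using assms
proof (induction us arbitrary: a)
  case Nil
  then show ?case by (auto intro!: eq_vecI simp: scalar_prod_def)
next
  case (Cons u us)
  have "mat_of_cols n us *\<^sub>v vec (length us) (\<lambda>i. a $ Suc i) \<in> span_list n us"
    using Cons by auto
  then show ?case
    using Cons.prems by (subst mat_of_cols_Cons_mult) auto
qed

lemma mat_of_cols_mult_eq_0:
  assumes "lin_indep n us" "a \<in> carrier_vec (length us)" "mat_of_cols n us *\<^sub>v a = 0\<^sub>v n"
  shows "a = 0\<^sub>v (length us)"
  using assms
proof (induction us arbitrary: a)
  case (Cons u us)
  let ?a = "vec (length us) (\<lambda>i. a $ Suc i)" and ?w = "mat_of_cols n us *\<^sub>v vec (length us) (\<lambda>i. a $ Suc i)"
  have us: "set us \<subseteq> carrier_vec n" "u \<in> carrier_vec n" "u \<notin> span_list n us"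
    using Cons.prems lin_indep_carrier by auto
  have w: "?w \<in> span_list n us" by (rule mat_of_cols_mult_in_span[OF us(1)]) simp
  have wc: "?w \<in> carrier_vec n" using w span_list_carrier[OF us(1)] by auto
  have eq: "a $ 0 \<cdot>\<^sub>v u + ?w = 0\<^sub>v n"
    using Cons.prems us by (subst mat_of_cols_Cons_mult[symmetric]) auto
  have eq': "a $ 0 * u $ i + ?w $ i = 0" if "i < n" for i
    using arg_cong[OF eq, of "\<lambda>v. v $ i"] that us(2) wc
    by (simp only: index_add_vec index_smult_vec carrier_vecD index_zero_vec)
  have a0: "a $ 0 = 0"
  proof (rule ccontr)
    assume nz: "a $ 0 \<noteq> 0"
    have "u = (- 1 / a $ 0) \<cdot>\<^sub>v ?w"
    proof (rule eq_vecI)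
      fix i assume "i < dim_vec ((- 1 / a $ 0) \<cdot>\<^sub>v ?w)"
      then have i: "i < n" by simp
      have "?w $ i = - (a $ 0 * u $ i)" using eq'[OF i] by (simp only: add_eq_0_iff)
      then show "u $ i = ((- 1 / a $ 0) \<cdot>\<^sub>v ?w) $ i"
        using i wc nz by (simp only: index_smult_vec carrier_vecD) simp
    qed (use us in simp)
    then show False using span_list_smult[OF us(1) w] us(3) by metis
  qed
  have "?w = 0\<^sub>v n"
  proof (rule eq_vecI)
    fix i assume "i < dim_vec (0\<^sub>v n :: 'a vec)"
    then show "?w $ i = 0\<^sub>v n $ i" using eq'[of i] a0 by simp
  qed simp
  then have a_tl: "?a = 0\<^sub>v (length us)" using Cons.IH[of ?a] Cons.prems by simp
  have "a $ Suc i = 0" if "i < length us" for i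
  proof -
    have "a $ Suc i = ?a $ i" using that by simp
    also have "\<dots> = 0" unfolding a_tl using that by simp
    finally show ?thesis .
  qed
  then have "a $ i = 0" if "i < Suc (length us)" for i using a0 that by (cases i) auto
  then show ?case using Cons.prems by (intro eq_vecI) auto
qed auto

lemma lin_indep_inverse:
  fixes us :: "'a :: field vec list"
  assumes "lin_indep n us" "length us = n"
  obtains P' where "P' \<in> carrier_mat n n" "mat_of_cols n us * P' = 1\<^sub>m n" "P' * mat_of_cols n us = 1\<^sub>m n"
proof -
  have P: "mat_of_cols n us \<in> carrier_mat n n" by (rule carrier_matI) (use assms in auto)
  have "det (mat_of_cols n us) \<noteq> 0"
    using det_0_iff_vec_prod_zero_field[OF P] mat_of_cols_mult_eq_0[OF assms(1)] assms(2) by auto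
  then show ?thesis using det_nonzero_inverse[OF P] that by blast
qed

lemma mat_of_cols_unit_vec:
  fixes us :: "'a :: field vec list"
  assumes "set us \<subseteq> carrier_vec n" "k < length us"
  shows "mat_of_cols n us *\<^sub>v unit_vec (length us) k = us ! k"
  using assms subsetD[OF assms(1) nth_mem[OF assms(2)]]
  by (intro eq_vecI) (auto simp: mat_of_cols_index)

lemma eq_mat_if_eq_on_basis:
  fixes us :: "'a :: field vec list"
  assumes us: "lin_indep n us" "length us = n"
    and M: "M \<in> carrier_mat n n" and N: "N \<in> carrier_mat n n"
    and eq: "\<And>u. u \<in> set us \<Longrightarrow> M *\<^sub>v u = N *\<^sub>v u"
  shows "M = N"
proof -
  let ?P = "mat_of_cols n us"
  obtain P' where P': "P' \<in> carrier_mat n n" "?P * P' = 1\<^sub>m n" by (rule lin_indep_inverse[OF us])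
  have P: "?P \<in> carrier_mat n n" by (rule carrier_matI) (use us in auto)
  have c: "set us \<subseteq> carrier_vec n" by (rule lin_indep_carrier[OF us(1)])
  have "M * ?P = N * ?P"
  proof (rule mat_col_eqI)
    fix j assume "j < dim_col (N * ?P)"
    then have j: "j < length us" by simp
    then have "col ?P j = us ! j" using c nth_mem[OF j] by (intro col_mat_of_cols) auto
    then have "col (K * ?P) j = K *\<^sub>v us ! j" if "K \<in> carrier_mat n n" for K :: "'a mat"
      using that P j us by (subst col_mult2[of _ n n _ n]) auto
    then show "col (M * ?P) j = col (N * ?P) j" using M N eq j by simp
  qed (use M N in auto)
  then have "M * ?P * P' = N * ?P * P'" by (simp only:)
  moreover have "K * ?P * P' = K" if "K \<in> carrier_mat n n" for K :: "'a mat"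
    by (subst assoc_mult_mat[OF that P P'(1)], subst P'(2), rule right_mult_one_mat[OF that])
  ultimately show ?thesis using M N by metis
qed

text \<open>\<open>r\<close> is the first row of the inverse of the basis matrix, the coordinate
  functional of \<open>u\<close>. It turns the difference of two matrices that agree on all of the
  basis but \<open>u\<close> into an outer product.\<close>

lemma lin_indep_dual_vec:
  fixes u :: "'a :: field vec"
  assumes us: "lin_indep n (u # us)" "length (u # us) = n"
  obtains r where "r \<in> carrier_vec n" "r \<bullet> u = 1" "\<forall>w\<in>set us. r \<bullet> w = 0"
    "\<forall>D\<in>carrier_mat n n. (\<forall>w\<in>set us. D *\<^sub>v w = 0\<^sub>v n) \<longrightarrow> D = outer (D *\<^sub>v u) r"
proof -
  let ?P = "mat_of_cols n (u # us)"
  obtain P' where P': "P' \<in> carrier_mat n n" "P' * ?P = 1\<^sub>m n" by (rule lin_indep_inverse[OF us])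
  have P: "?P \<in> carrier_mat n n" by (rule carrier_matI) (use us in auto)
  have c: "set (u # us) \<subseteq> carrier_vec n" by (rule lin_indep_carrier[OF us(1)])
  have n: "0 < n" using us by auto
  define r where "r = row P' 0"
  have r: "r \<in> carrier_vec n" using P' n unfolding r_def by auto
  have rw: "r \<bullet> ((u # us) ! k) = (if k = 0 then 1 else 0)" if k: "k < n" for k
  proof -
    have "(P' * ?P) $$ (0, k) = r \<bullet> col ?P k"
      unfolding r_def by (rule index_mult_mat) (use k n P P' in auto)
    moreover have "col ?P k = (u # us) ! k"
      by (rule col_mat_of_cols) (use k us c nth_mem[of k "u # us"] in auto)
    ultimately have "r \<bullet> ((u # us) ! k) = (P' * ?P) $$ (0, k)" by simp
    then show ?thesis using k n by (simp only: P') simp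
  qed
  have ru: "r \<bullet> u = 1" using rw[of 0] n by simp
  have rus: "r \<bullet> w = 0" if "w \<in> set us" for w
  proof -
    from that have "\<exists>k<length us. us ! k = w" by (simp only: in_set_conv_nth)
    then obtain k where "k < length us" "us ! k = w" by blast
    then show ?thesis using rw[of "Suc k"] us by simp
  qed
  have "D = outer (D *\<^sub>v u) r"
    if D: "D \<in> carrier_mat n n" "\<And>w. w \<in> set us \<Longrightarrow> D *\<^sub>v w = 0\<^sub>v n" for D
  proof (rule eq_mat_if_eq_on_basis[OF us D(1)])
    have Du: "D *\<^sub>v u \<in> carrier_vec n" using D c by auto
    then show "outer (D *\<^sub>v u) r \<in> carrier_mat n n" using r by simp
    fix w assume w: "w \<in> set (u # us)"
    have "1 \<cdot>\<^sub>v x = x" "0 \<cdot>\<^sub>v x = 0\<^sub>v n" if "x \<in> carrier_vec n" for x :: "'a vec"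
      using that by (auto intro!: eq_vecI)
    from this[OF Du] show "D *\<^sub>v w = outer (D *\<^sub>v u) r *\<^sub>v w"
      using w c D ru rus by (subst outer_mult_vec[OF Du r]) auto
  qed
  then show ?thesis using that[OF r ru] rus by blast
qed

section \<open>Adaptive counting\<close>

text \<open>\<open>T xs\<close> is the set forbidden to the element chosen after \<open>xs\<close>,
  the list being built from its end; some choice was a forbidden one.\<close>

fun hits :: "('b list \<Rightarrow> 'b set) \<Rightarrow> 'b list \<Rightarrow> bool" where
  "hits T [] \<longleftrightarrow> False"
| "hits T (x # xs) \<longleftrightarrow> hits T xs \<or> x \<in> T xs"

text \<open>The first forbidden choice after k elements accounts for at most |R|^(l-1) q^(k+s)
  lists. The geometric sum over k < l is at most q^(l+s)/(q-1), and the factor (q-1)|R| on the left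
  clears all denominators.\<close>

lemma card_hits:
  fixes q s :: nat
  assumes R: "finite R" and q: "q \<ge> 1"
    and T: "\<And>xs. set xs \<subseteq> R \<Longrightarrow> card (T xs \<inter> R) \<le> q ^ (length xs + s)"
  shows "(q - 1) * card R * card {xs. set xs \<subseteq> R \<and> length xs = l \<and> hits T xs} \<le> card R ^ l * q ^ (l + s)"
proof (induction l)
  case (Suc l)
  define L where "L = {xs. set xs \<subseteq> R \<and> length xs = l}"
  define F where "F k = {xs. set xs \<subseteq> R \<and> length xs = k \<and> hits T xs}" for k
  have L: "finite L" "card L = card R ^ l"
    using finite_lists_length_eq[OF R] card_lists_length_eq[OF R] by (auto simp: L_def)
  have "F l \<subseteq> L" by (auto simp: F_def L_def)
  then have F: "finite (F l)" using L finite_subset by blast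
  have "F (Suc l) \<subseteq> (\<lambda>(x, xs). x # xs) ` (R \<times> F l) \<union> (\<lambda>(xs, x). x # xs) ` (SIGMA xs:L. T xs \<inter> R)"
  proof
    fix zs assume zs: "zs \<in> F (Suc l)"
    then obtain x xs where "zs = x # xs" by (cases zs) (auto simp: F_def)
    then show "zs \<in> (\<lambda>(x, xs). x # xs) ` (R \<times> F l) \<union> (\<lambda>(xs, x). x # xs) ` (SIGMA xs:L. T xs \<inter> R)"
      using zs by (auto simp: F_def L_def image_iff)
  qed
  moreover have fin: "finite ((\<lambda>(x, xs). x # xs) ` (R \<times> F l))"
    "finite ((\<lambda>(xs, x). x # xs) ` (SIGMA xs:L. T xs \<inter> R))"
    using F L R by auto
  ultimately have "card (F (Suc l)) \<le> card ((\<lambda>(x, xs). x # xs) ` (R \<times> F l) \<union> (\<lambda>(xs, x). x # xs) ` (SIGMA xs:L. T xs \<inter> R))"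
    by (intro card_mono) auto
  also have "\<dots> \<le> card ((\<lambda>(x, xs). x # xs) ` (R \<times> F l)) + card ((\<lambda>(xs, x). x # xs) ` (SIGMA xs:L. T xs \<inter> R))"
    by (rule card_Un_le)
  also have "card ((\<lambda>(x, xs). x # xs) ` (R \<times> F l)) \<le> card R * card (F l)"
    using card_image_le[of "R \<times> F l" "\<lambda>(x, xs). x # xs"] F R by (simp add: card_cartesian_product)
  also have "card ((\<lambda>(xs, x). x # xs) ` (SIGMA xs:L. T xs \<inter> R)) \<le> card (SIGMA xs:L. T xs \<inter> R)"
    by (rule card_image_le) (use L R in auto)
  also have "card (SIGMA xs:L. T xs \<inter> R) = (\<Sum>xs\<in>L. card (T xs \<inter> R))"
    using L R by (subst card_SigmaI) auto
  also have "\<dots> \<le> (\<Sum>xs\<in>L. q ^ (l + s))"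
    by (rule sum_mono) (use T in \<open>auto simp: L_def\<close>)
  also have "\<dots> = card R ^ l * q ^ (l + s)" using L by simp
  finally have *: "card (F (Suc l)) \<le> card R * card (F l) + card R ^ l * q ^ (l + s)" by simp
  have IH: "(q - 1) * card R * card (F l) \<le> card R ^ l * q ^ (l + s)"
    using Suc.IH by (simp only: F_def)
  obtain k where k: "q = Suc k" using q by (cases q) auto
  have "(q - 1) * card R * card (F (Suc l))
      \<le> card R * ((q - 1) * card R * card (F l)) + (q - 1) * card R * (card R ^ l * q ^ (l + s))"
    using mult_le_mono2[OF *, of "(q - 1) * card R"] by (simp add: algebra_simps)
  also have "\<dots> \<le> card R * (card R ^ l * q ^ (l + s)) + (q - 1) * card R * (card R ^ l * q ^ (l + s))"
    using IH by simp
  also have "\<dots> = card R ^ Suc l * q ^ (Suc l + s)"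
    by (simp add: k algebra_simps)
  finally show ?case by (simp only: F_def)
next
  case 0
  have "{xs. set xs \<subseteq> R \<and> length xs = 0 \<and> hits T xs} = {}" by auto
  then show ?case by (simp only: card.empty)
qed

section \<open>Matrices with a given eigenvector\<close>

lemma finite_carrier_mat [simp]: "finite (carrier_mat m n :: 'a :: finite mat set)"
proof (rule finite_subset)
  let ?L = "{us :: 'a vec list. set us \<subseteq> carrier_vec m \<and> length us = n}"
  show "finite (mat_of_cols m ` ?L)"
    by (intro finite_imageI finite_lists_length_eq finite_carrier_vec)
  show "carrier_mat m n \<subseteq> mat_of_cols m ` ?L"
  proof
    fix A :: "'a mat" assume A: "A \<in> carrier_mat m n"
    then have "A = mat_of_cols m (cols A)" by (metis mat_of_cols_cols carrier_matD(1))
    moreover have "cols A \<in> ?L" using A cols_dim[of A] by auto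
    ultimately show "A \<in> mat_of_cols m ` ?L" by blast
  qed
qed

lemma eq_0_if_scalar_prod_eq_0:
  fixes r :: "'a :: comm_ring_1 vec"
  assumes "r \<in> carrier_vec n" "\<And>s. s \<in> carrier_vec n \<Longrightarrow> r \<bullet> s = 0"
  shows "r = 0\<^sub>v n"
proof (rule eq_vecI)
  fix i assume "i < dim_vec (0\<^sub>v n :: 'a vec)"
  then show "r $ i = 0\<^sub>v n $ i" using assms(2)[of "unit_vec n i"] by simp
qed (use assms in simp)

lemma card_orthogonal:
  fixes v :: "'a :: {field, finite} vec"
  assumes v: "v \<in> carrier_vec n" "v \<noteq> 0\<^sub>v n"
  shows "card (UNIV :: 'a set) * card {r \<in> carrier_vec n. r \<bullet> v = 0} = card (UNIV :: 'a set) ^ n"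
proof -
  obtain i where i: "i < n" "v $ i \<noteq> 0" using v by (auto simp: vec_eq_iff)
  let ?O = "{r \<in> carrier_vec n. r \<bullet> v = 0}" and ?e = "unit_vec n i :: 'a vec"
  have e: "?e \<in> carrier_vec n" by simp
  have dot: "(r + t \<cdot>\<^sub>v ?e) \<bullet> v = r \<bullet> v + t * v $ i" if "r \<in> carrier_vec n" for r t
    using that v i by (simp add: add_scalar_prod_distrib[of _ n] smult_scalar_prod_distrib[of _ n])
  have "bij_betw (\<lambda>(t, r). r + t \<cdot>\<^sub>v ?e) (UNIV \<times> ?O) (carrier_vec n)"
  proof (rule bij_betw_byWitness[where f' = "\<lambda>r. (r \<bullet> v / v $ i, r + (- (r \<bullet> v / v $ i)) \<cdot>\<^sub>v ?e)"], goal_cases)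
    case 1
    have "((r + t \<cdot>\<^sub>v ?e) \<bullet> v / v $ i,
          (r + t \<cdot>\<^sub>v ?e) + (- ((r + t \<cdot>\<^sub>v ?e) \<bullet> v / v $ i)) \<cdot>\<^sub>v ?e) = (t, r)"
      if r: "r \<in> carrier_vec n" "r \<bullet> v = 0" for t r
    proof -
      have "(r + t \<cdot>\<^sub>v ?e) \<bullet> v / v $ i = t" using dot[OF r(1), of t] r i by simp
      moreover have "r + t \<cdot>\<^sub>v ?e + (- t) \<cdot>\<^sub>v ?e = r" using r by (intro eq_vecI) auto
      ultimately show ?thesis by (simp only:)
    qed
    then show ?case by auto
  next
    case 2
    show ?case by (auto intro!: eq_vecI)
  next
    case 3
    show ?case by auto
  next
    case 4
    have "(r + (- (r \<bullet> v / v $ i)) \<cdot>\<^sub>v ?e) \<bullet> v = 0" if "r \<in> carrier_vec n" for r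
      using dot[OF that, of "- (r \<bullet> v / v $ i)"] i by simp
    then show ?case by auto
  qed
  then have "card ((UNIV :: 'a set) \<times> ?O) = card (carrier_vec n :: 'a vec set)" by (rule bij_betw_same_card)
  then show ?thesis by (simp add: card_carrier_vec card_cartesian_product)
qed

text \<open>Existence from uniqueness: sending \<open>r\<close> to its pairings with the n tails is
  an injective self-map of the finite set F^n because \<open>b\<close> is cyclic, hence surjective.
  The remaining coefficients agree because both polynomials are monic of degree n.\<close>

lemma exists_char_poly_minus_outer:
  fixes A :: "'a :: {field, finite} mat"
  assumes A: "A \<in> carrier_mat n n" and b: "b \<in> carrier_vec n" "cyclic_vec A b"
    and B: "B \<in> carrier_mat n n"
  obtains r where "r \<in> carrier_vec n" "char_poly (A - outer b r) = char_poly B"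
proof -
  let ?W = "\<lambda>k. act A (poly_shift (Suc k) (char_poly A)) b"
  let ?F = "\<lambda>r. vec n (\<lambda>k. r \<bullet> ?W k)"
  have W: "?W k \<in> carrier_vec n" for k by (rule act_closed[OF A b(1)])
  have "inj_on ?F (carrier_vec n)"
  proof (rule inj_onI)
    fix r s :: "'a vec" assume r: "r \<in> carrier_vec n" and s: "s \<in> carrier_vec n" and eq: "?F r = ?F s"
    have "(r - s) \<bullet> ?W k = 0" for k
    proof (cases "k < n")
      case True
      then show ?thesis
        using arg_cong[OF eq, of "\<lambda>v. v $ k"] W[of k] r s by (simp add: minus_scalar_prod_distrib[of _ n])
    next
      case False
      then have "poly_shift (Suc k) (char_poly A) = 0"
        using degree_monic_char_poly[OF A]
        by (intro poly_eqI) (simp add: coeff_poly_shift coeff_eq_0)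
      then show ?thesis using r s b by (simp add: act_0[OF A])
    qed
    then have *: "(r - s) \<bullet> act A p b = 0" for p
      using scalar_act_eq_0[OF A b(1), of "r - s"] r s by simp
    have "r - s = 0\<^sub>v n"
    proof (rule eq_0_if_scalar_prod_eq_0)
      fix w :: "'a vec" assume "w \<in> carrier_vec n"
      then obtain p where "act A p b = w" using act_surj[OF A b] by blast
      then show "(r - s) \<bullet> w = 0" using *[of p] by simp
    qed (use r s in simp)
    then show "r = s" using r s by (auto simp: vec_eq_iff)
  qed
  then have "?F ` carrier_vec n = carrier_vec n"
    by (intro endo_inj_surj) (auto simp: finite_carrier_vec)
  then have "vec n (\<lambda>k. coeff (char_poly B) k - coeff (char_poly A) k) \<in> ?F ` carrier_vec n" by simp
  then obtain r where r: "r \<in> carrier_vec n"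
    "vec n (\<lambda>k. coeff (char_poly B) k - coeff (char_poly A) k) = ?F r" by blast
  have AB: "A - outer b r \<in> carrier_mat n n" by (intro minus_carrier_mat outer_carrier b r)
  have "char_poly (A - outer b r) = char_poly B"
  proof (rule poly_eqI)
    fix k
    consider "k < n" | "k = n" | "k > n" by linarith
    then show "coeff (char_poly (A - outer b r)) k = coeff (char_poly B) k"
    proof cases
      case 1
      then show ?thesis
        using arg_cong[OF r(2), of "\<lambda>v. v $ k"] coeff_char_poly_minus_outer[OF A b(1) r(1), of k]
        by (simp, metis add.commute diff_add_cancel)
    next
      case 2
      then show ?thesis using degree_monic_char_poly[OF AB] degree_monic_char_poly[OF B] by simp
    next
      case 3
      then show ?thesis using degree_monic_char_poly[OF AB] degree_monic_char_poly[OF B] by (simp add: coeff_eq_0)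
    qed
  qed
  then show ?thesis using that r(1) by blast
qed

lemma minus_add_outer:
  fixes z y :: "'a :: comm_ring_1 mat"
  assumes "z \<in> carrier_mat n n" "y \<in> carrier_mat n n" "v \<in> carrier_vec n" "r \<in> carrier_vec n"
  shows "z - (y + outer v r) = (z - y) - outer v r"
  using assms by (intro eq_matI) (auto simp: outer_def)

lemma add_outer_uminus:
  fixes y :: "'a :: comm_ring_1 mat"
  assumes "y \<in> carrier_mat n n" "v \<in> carrier_vec n" "r \<in> carrier_vec n"
  shows "y + outer v r = y - outer v (- r)" "y + outer v r + outer v (- r) = y"
  using assms by (auto intro!: eq_matI simp: outer_def)

lemma similar_if_irreducible_char_poly:
  fixes A B :: "'a :: field mat"
  assumes A: "A \<in> carrier_mat n n" and B: "B \<in> carrier_mat n n" and "n > 0"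
    and irr: "irreducible (char_poly A)" and eq: "char_poly B = char_poly A"
  shows "similar_mat B A"
proof -
  let ?e = "unit_vec n 0 :: 'a vec"
  have e: "?e \<in> carrier_vec n" "?e \<noteq> 0\<^sub>v n" using \<open>n > 0\<close> by auto
  show ?thesis
    using similar_if_cyclic[OF B e(1) _ A e(1) _ eq]
      cyclic_vec_if_irreducible[OF A e(1) irr e(2)] cyclic_vec_if_irreducible[OF B e(1) _ e(2)] irr eq
    by simp
qed

section \<open>The class Y as the set of all matrices with characteristic polynomial (T - l)
  h\<close>

locale linear_times_irreducible_class =
  fixes n :: nat and l :: "'a :: {field, finite}" and h :: "'a poly" and q :: nat
  assumes n: "n \<ge> 2"
    and irr: "irreducible h"
    and hl: "poly h l \<noteq> 0"
    and q: "q = card (UNIV :: 'a set)"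
begin

definition Ys :: "'a mat set" where
  "Ys = {y \<in> carrier_mat n n. char_poly y = [:- l, 1:] * h}"

definition Yv :: "'a vec \<Rightarrow> 'a mat set" where
  "Yv v = {y \<in> Ys. y *\<^sub>v v = l \<cdot>\<^sub>v v}"

lemma Ys_carrier: "y \<in> Ys \<Longrightarrow> y \<in> carrier_mat n n" by (simp add: Ys_def)

lemma Ys_locale: "y \<in> Ys \<Longrightarrow> linear_times_irreducible y n l h"
  by unfold_locales (use n irr hl in \<open>auto simp: Ys_def\<close>)

lemma finite_Ys [simp]: "finite Ys" "finite (Yv v)"
  by (auto simp: Yv_def Ys_def)

lemma Ys_similar:
  assumes "y \<in> Ys" "y' \<in> Ys"
  shows "similar_mat y y'"
proof -
  interpret y: linear_times_irreducible y n l h by (rule Ys_locale[OF assms(1)])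
  interpret y': linear_times_irreducible y' n l h by (rule Ys_locale[OF assms(2)])
  obtain v u where "v \<in> carrier_vec n" "u \<in> carrier_vec n" "cyclic_vec y (v + u)"
    by (rule y.exists_basis_vectors)
  moreover obtain v' u' where "v' \<in> carrier_vec n" "u' \<in> carrier_vec n" "cyclic_vec y' (v' + u')"
    by (rule y'.exists_basis_vectors)
  ultimately show ?thesis
    using y.y y'.y y.cp y'.cp by (intro similar_if_cyclic[of y n "v + u" y' "v' + u'"]) auto
qed

lemma card_eigenvectors:
  assumes y: "y \<in> Ys"
  shows "card {v \<in> carrier_vec n - {0\<^sub>v n}. y *\<^sub>v v = l \<cdot>\<^sub>v v} = q - 1"
proof -
  interpret y: linear_times_irreducible y n l h by (rule Ys_locale[OF y])
  obtain v where v: "v \<in> carrier_vec n" "v \<noteq> 0\<^sub>v n" "y *\<^sub>v v = l \<cdot>\<^sub>v v" by (rule y.exists_eigenvector)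
  obtain i where i: "i < n" "v $ i \<noteq> 0" using v by (auto simp: vec_eq_iff)
  have "{w \<in> carrier_vec n - {0\<^sub>v n}. y *\<^sub>v w = l \<cdot>\<^sub>v w} = (\<lambda>t. t \<cdot>\<^sub>v v) ` (UNIV - {0})"
  proof (intro equalityI subsetI)
    fix w assume "w \<in> {w \<in> carrier_vec n - {0\<^sub>v n}. y *\<^sub>v w = l \<cdot>\<^sub>v w}"
    then have w: "w \<in> carrier_vec n" "y *\<^sub>v w = l \<cdot>\<^sub>v w" "w \<noteq> 0\<^sub>v n" by auto
    obtain t where t: "w = t \<cdot>\<^sub>v v" by (rule y.eigenvector_unique[OF v w(1,2)])
    moreover have "t \<noteq> 0" using w(3) v(1) t by (auto simp: vec_eq_iff)
    ultimately show "w \<in> (\<lambda>t. t \<cdot>\<^sub>v v) ` (UNIV - {0})" by blast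
  next
    fix w assume "w \<in> (\<lambda>t. t \<cdot>\<^sub>v v) ` (UNIV - {0})"
    then obtain t where t: "w = t \<cdot>\<^sub>v v" "t \<noteq> 0" by auto
    have "y *\<^sub>v w = l \<cdot>\<^sub>v w"
      using v unfolding t mult_smult_vec[OF y.y v(1)] by (auto simp: smult_smult_assoc mult.commute)
    moreover have "w \<noteq> 0\<^sub>v n"
    proof
      assume "w = 0\<^sub>v n"
      moreover have "w $ i = t * v $ i" using i v t by simp
      ultimately show False using i t by simp
    qed
    ultimately show "w \<in> {w \<in> carrier_vec n - {0\<^sub>v n}. y *\<^sub>v w = l \<cdot>\<^sub>v w}" using v t by simp
  qed
  moreover have "inj_on (\<lambda>t. t \<cdot>\<^sub>v v) (UNIV - {0})"
  proof (rule inj_onI)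
    fix s t assume "s \<cdot>\<^sub>v v = t \<cdot>\<^sub>v v"
    then have "(s \<cdot>\<^sub>v v) $ i = (t \<cdot>\<^sub>v v) $ i" by simp
    then show "s = t" using i v by simp
  qed
  ultimately show ?thesis by (simp add: card_image card_Diff_singleton q)
qed

text \<open>Double counting of pairs (v, y). This is where the factor q - 1 carried through all
  later estimates comes from.\<close>

lemma sum_card_eigenvectors:
  assumes "S \<subseteq> Ys"
  shows "(\<Sum>v\<in>carrier_vec n - {0\<^sub>v n}. card {y \<in> S. y *\<^sub>v v = l \<cdot>\<^sub>v v}) = (q - 1) * card S"
proof (rule sum_multicount)
  show "finite S" using assms finite_Ys(1) finite_subset by blast
  show "\<forall>y\<in>S. card {v \<in> carrier_vec n - {0\<^sub>v n}. y *\<^sub>v v = l \<cdot>\<^sub>v v} = q - 1"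
    using card_eigenvectors assms by auto
qed simp

text \<open>Since \<open>v\<close> is an eigenvector of \<open>y\<close>, every Horner tail maps it
  to a multiple of itself, which is orthogonal to \<open>r\<close>. So no coefficient of the
  characteristic polynomial moves.\<close>

lemma Yv_add_outer:
  assumes y: "y \<in> Yv v" and v: "v \<in> carrier_vec n" and r: "r \<in> carrier_vec n" "r \<bullet> v = 0"
  shows "y + outer v r \<in> Yv v"
proof -
  have yc: "y \<in> carrier_mat n n" and yv: "y *\<^sub>v v = l \<cdot>\<^sub>v v" and cp: "char_poly y = [:- l, 1:] * h"
    using y by (auto simp: Yv_def Ys_def)
  have "char_poly (y - outer v (- r)) = char_poly y"
  proof (rule poly_eqI)
    fix k
    have "(- r) \<bullet> v = 0" using r v by simp
    then show "coeff (char_poly (y - outer v (- r))) k = coeff (char_poly y) k"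
      using r v by (subst coeff_char_poly_minus_outer[OF yc v])
        (simp_all add: act_eigenvector[OF yc v yv] del: uminus_scalar_prod)
  qed
  moreover have "(y + outer v r) *\<^sub>v v = l \<cdot>\<^sub>v v"
  proof -
    have "(y + outer v r) *\<^sub>v v = y *\<^sub>v v + outer v r *\<^sub>v v"
      by (rule add_mult_distrib_mat_vec[OF yc outer_carrier[OF v r(1)] v])
    also have "\<dots> = l \<cdot>\<^sub>v v" using v r by (simp add: yv outer_mult_vec) (intro eq_vecI, auto)
    finally show ?thesis .
  qed
  moreover have "y + outer v r \<in> carrier_mat n n"
    by (rule add_carrier_mat[OF outer_carrier[OF v r(1)]])
  ultimately show ?thesis
    unfolding Yv_def Ys_def add_outer_uminus(1)[OF yc v r(1)] by (simp only: mem_Collect_eq cp)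
qed

end

section \<open>Pairs with a given eigenvector: comparison with cyclicity of v\<close>

context linear_times_irreducible_class
begin

text \<open>The map (y, r) to y + v r^T, with \<open>r\<close> orthogonal to \<open>v\<close>, is
  injective into \<open>Yv v\<close>: if two such y differ by v s^T and the differences z - y have
  the same characteristic polynomial, then s = 0 as \<open>v\<close> is cyclic. There are q^(n-1)
  choices of \<open>r\<close>; the extra factor q on both sides avoids that exponent.\<close>

lemma card_Yv_sum_irreducible_le:
  fixes z :: "'a mat"
  assumes z: "z \<in> carrier_mat n n" and v: "v \<in> carrier_vec n" "v \<noteq> 0\<^sub>v n" and f: "irreducible f"
  shows "q ^ n * card {y \<in> Yv v. char_poly (z - y) = f} \<le> q * card (Yv v)"
proof -
  let ?N = "{y \<in> Yv v. char_poly (z - y) = f}" and ?O = "{r \<in> carrier_vec n. r \<bullet> v = 0}"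
  let ?g = "\<lambda>(y, r). y + outer v r"
  have yc: "y \<in> carrier_mat n n" if "y \<in> Yv v" for y using that by (auto simp: Yv_def Ys_def)
  have "inj_on ?g (?N \<times> ?O)"
  proof (rule inj_onI, clarify)
    fix y r y' r'
    assume y: "y \<in> Yv v" "f = char_poly (z - y)" and y': "y' \<in> Yv v" "char_poly (z - y') = char_poly (z - y)"
      and r: "r \<in> carrier_vec n" "r \<bullet> v = 0" and r': "r' \<in> carrier_vec n" "r' \<bullet> v = 0"
      and eq: "y + outer v r = y' + outer v r'"
    note c = yc[OF y(1)] yc[OF y'(1)]
    have zy: "z - y \<in> carrier_mat n n" by (rule minus_carrier_mat[OF c(1)])
    have d: "r - r' \<in> carrier_vec n" using r r' by simp
    have "y' = y + outer v (r - r')"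
    proof (rule eq_matI)
      fix i j assume "i < dim_row (y + outer v (r - r'))" "j < dim_col (y + outer v (r - r'))"
      then show "y' $$ (i, j) = (y + outer v (r - r')) $$ (i, j)"
        using c v r r' arg_cong[OF eq, of "\<lambda>M. M $$ (i, j)"]
        by (simp add: outer_def algebra_simps)
    qed (use c v r r' in \<open>auto simp: outer_def\<close>)
    then have y'_eq: "z - y' = (z - y) - outer v (r - r')"
      using minus_add_outer[OF z c(1) v(1) d] by simp
    have cyc: "cyclic_vec (z - y) v"
      by (rule cyclic_vec_if_irreducible[OF zy v(1) _ v(2)]) (use f y in simp)
    have 0: "(r - r') \<bullet> act (z - y) p v = 0" for p
      by (rule scalar_act_eq_0_if_char_poly_eq[OF zy v(1) d]) (use y'(2) y'_eq in simp)
    have "r - r' = 0\<^sub>v n"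
    proof (rule eq_0_if_scalar_prod_eq_0[OF d])
      fix w :: "'a vec" assume "w \<in> carrier_vec n"
      then obtain p where "act (z - y) p v = w" using act_surj[OF zy v(1) cyc] by blast
      then show "(r - r') \<bullet> w = 0" using 0[of p] by simp
    qed
    then have rr: "r = r'" using r r' by (auto simp: vec_eq_iff)
    have "y + outer v r + outer v (- r) = y' + outer v r' + outer v (- r')" using eq rr by simp
    then show "y = y' \<and> r = r'" using rr add_outer_uminus(2) c v r r' by metis
  qed
  moreover have "?g ` (?N \<times> ?O) \<subseteq> Yv v" using Yv_add_outer v by auto
  ultimately have "card (?N \<times> ?O) \<le> card (Yv v)" by (intro card_inj_on_le finite_Ys) auto
  then have "q * (card ?N * card ?O) \<le> q * card (Yv v)"
    by (simp only: card_cartesian_product mult_le_mono2)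
  moreover have "q * (card ?N * card ?O) = q ^ n * card ?N"
    unfolding q card_orthogonal[OF v, symmetric] by (simp only: mult_ac)
  ultimately show ?thesis by simp
qed

text \<open>The map used for the opposite inequality now covers every \<open>y\<close> for which
  \<open>v\<close> is cyclic: some \<open>r\<close> moves the characteristic polynomial of z - y to
  that of \<open>x0\<close>, and the trace condition forces \<open>r\<close> to be orthogonal to
  \<open>v\<close>.\<close>

lemma card_Yv_cyclic_le:
  fixes z :: "'a mat"
  assumes z: "z \<in> carrier_mat n n" and v: "v \<in> carrier_vec n" "v \<noteq> 0\<^sub>v n"
    and x0: "x0 \<in> carrier_mat n n" "irreducible (char_poly x0)"
    and trace: "\<And>y. y \<in> Ys \<Longrightarrow> mat_trace z = mat_trace x0 + mat_trace y"
  shows "q * card {y \<in> Yv v. cyclic_vec (z - y) v}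
    \<le> q ^ n * card {y \<in> Yv v. char_poly (z - y) = char_poly x0}"
proof -
  let ?N = "{y \<in> Yv v. char_poly (z - y) = char_poly x0}" and ?O = "{r \<in> carrier_vec n. r \<bullet> v = 0}"
  let ?g = "\<lambda>(y, r). y + outer v r"
  have "{y \<in> Yv v. cyclic_vec (z - y) v} \<subseteq> ?g ` (?N \<times> ?O)"
  proof
    fix y assume "y \<in> {y \<in> Yv v. cyclic_vec (z - y) v}"
    then have y: "y \<in> Yv v" and cyc: "cyclic_vec (z - y) v" by auto
    then have yY: "y \<in> Ys" and yc: "y \<in> carrier_mat n n" by (auto simp: Yv_def Ys_def)
    have zy: "z - y \<in> carrier_mat n n" by (rule minus_carrier_mat[OF yc])
    obtain r where r: "r \<in> carrier_vec n" "char_poly (z - y - outer v r) = char_poly x0"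
      by (rule exists_char_poly_minus_outer[OF zy v(1) cyc x0(1)])
    have xc: "z - y - outer v r \<in> carrier_mat n n"
      by (rule minus_carrier_mat[OF outer_carrier[OF v(1) r(1)]])
    have "mat_trace (z - y - outer v r) = mat_trace x0"
      by (rule mat_trace_similar[OF similar_if_irreducible_char_poly[OF x0(1) xc _ x0(2) r(2)]]) (use n in simp)
    \<comment> \<open>The outer product has trace r.v, so the trace prescribed for \<open>z\<close>
      leaves r.v = 0.\<close>
    moreover have "mat_trace (z - y - outer v r) = mat_trace z - mat_trace y - r \<bullet> v"
      unfolding mat_trace_outer[OF v(1) r(1), symmetric]
      using z yc v r by (simp add: mat_trace_def sum_subtractf outer_def)
    ultimately have rv: "r \<bullet> v = 0" using trace[OF yY] by simp
    have "y + outer v r \<in> ?N"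
      using Yv_add_outer[OF y v(1) r(1) rv] r(2) minus_add_outer[OF z yc v(1) r(1)] by simp
    moreover have "- r \<in> ?O" using r(1) v(1) rv by simp
    moreover have "y = ?g (y + outer v r, - r)" using add_outer_uminus(2)[OF yc v(1) r(1)] by simp
    ultimately show "y \<in> ?g ` (?N \<times> ?O)" by blast
  qed
  moreover have "finite (?N \<times> ?O)" by simp
  ultimately have "card {y \<in> Yv v. cyclic_vec (z - y) v} \<le> card (?N \<times> ?O)"
    by (meson card_image_le card_mono finite_imageI le_trans)
  then have "q * card {y \<in> Yv v. cyclic_vec (z - y) v} \<le> q * (card ?N * card ?O)"
    by (simp only: card_cartesian_product mult_le_mono2)
  also have "q * (card ?N * card ?O) = q ^ n * card ?N"
    unfolding q card_orthogonal[OF v, symmetric] by (simp only: mult_ac)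
  finally show ?thesis .
qed

text \<open>Here \<open>v\<close> is an eigenvector of z - y, hence killed by a polynomial of degree
  1 < n. But every nonzero vector is cyclic for a matrix with irreducible characteristic
  polynomial.\<close>

lemma Yv_sum_irreducible_empty:
  fixes z :: "'a mat"
  assumes z: "z \<in> carrier_mat n n" and v: "v \<in> carrier_vec n" "v \<noteq> 0\<^sub>v n" "z *\<^sub>v v = t \<cdot>\<^sub>v v"
    and f: "irreducible f"
  shows "{y \<in> Yv v. char_poly (z - y) = f} = {}"
proof -
  have False if y: "y \<in> Yv v" "char_poly (z - y) = f" for y
  proof -
    have yc: "y \<in> carrier_mat n n" and yv: "y *\<^sub>v v = l \<cdot>\<^sub>v v" using y by (auto simp: Yv_def Ys_def)
    have zy: "z - y \<in> carrier_mat n n" by (rule minus_carrier_mat[OF yc])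
    have "(z - y) *\<^sub>v v = z *\<^sub>v v - y *\<^sub>v v" by (rule minus_mult_distrib_mat_vec[OF z yc v(1)])
    also have "\<dots> = (t - l) \<cdot>\<^sub>v v"
      unfolding yv v(3) using v(1) by (intro eq_vecI) (auto simp: algebra_simps)
    finally have "act (z - y) [:- (t - l), 1:] v = poly [:- (t - l), 1:] (t - l) \<cdot>\<^sub>v v"
      by (intro act_eigenvector[OF zy v(1)])
    also have "\<dots> = 0\<^sub>v n" using v(1) by (intro eq_vecI) auto
    finally have "n \<le> degree [:- (t - l), 1:]"
      using cyclic_vec_if_irreducible[OF zy v(1) _ v(2)] f y cyclic_vec_iff[OF zy v(1)] by fastforce
    then show False using n by simp
  qed
  then show ?thesis by blast
qed

end

section \<open>Adaptive evaluation of a matrix along a Krylov sequence\<close>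

text \<open>The vectors \<open>v, u\<^sub>2, u\<^sub>3, \<dots>\<close> on which a matrix \<open>y\<close> is evaluated, newest first, as a function
  of the answers \<open>y u\<^sub>2, y u\<^sub>3, \<dots>\<close> received so far: as long as possible they are the iterates
  of \<open>v\<close> under \<open>z - y\<close>.\<close>
locale adaptive_queries =
  fixes n :: nat and z :: "'a :: {field, finite} mat" and c v :: "'a vec"
  assumes z: "z \<in> carrier_mat n n" and indep: "lin_indep n [c, v]"
begin

text \<open>The arbitrary choice outside the span takes over once the iterates become dependent. It
  keeps the queries independent, so that any n - 2 answers are informative.\<close>

definition next_query :: "'a vec list \<Rightarrow> 'a vec \<Rightarrow> 'a vec" where
  "next_query us a = (let w = z *\<^sub>v hd us - a in
     if w \<in> carrier_vec n - span_list n us then w else SOME w. w \<in> carrier_vec n - span_list n us)"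

text \<open>The head is the pending query and the tail has been answered. The answer at
  \<open>v\<close> is known beforehand to be the eigenvalue multiple of \<open>v\<close>, so
  \<open>c\<close> is the first vector really queried; where cyclicity matters it is (z - y) v, the
  same for all y with eigenvector \<open>v\<close>.\<close>

primrec queries :: "'a vec list \<Rightarrow> 'a vec list" where
  "queries [] = [c, v]"
| "queries (a # xs) = next_query (queries xs) a # queries xs"

primrec answers :: "'a mat \<Rightarrow> nat \<Rightarrow> 'a vec list" where
  "answers y 0 = []"
| "answers y (Suc k) = y *\<^sub>v hd (queries (answers y k)) # answers y k"

definition stops :: "'a vec list \<Rightarrow> 'a vec set" where
  "stops xs = {a. z *\<^sub>v hd (queries xs) - a \<in> span_list n (queries xs)}"

lemma length_queries [simp]: "length (queries xs) = length xs + 2"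
  by (induction xs) auto

lemma length_answers [simp]: "length (answers y k) = k"
  by (induction k) auto

lemma lin_indep_queries: "length xs + 2 \<le> n \<Longrightarrow> lin_indep n (queries xs)"
proof (induction xs)
  case (Cons a xs)
  obtain w where "w \<in> carrier_vec n - span_list n (queries xs)"
    using exists_not_in_span[of "queries xs" n] Cons.prems by auto
  then have "(SOME w. w \<in> carrier_vec n - span_list n (queries xs)) \<in> carrier_vec n - span_list n (queries xs)"
    by (rule someI)
  then have "next_query (queries xs) a \<in> carrier_vec n - span_list n (queries xs)"
    by (simp add: next_query_def Let_def)
  then show ?case using Cons by simp
qed (use indep in simp)

lemma queries_hd_tl: "queries xs = hd (queries xs) # tl (queries xs)"
  by (cases xs) auto

lemma v_in_tl_queries: "v \<in> set (tl (queries xs))"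
proof (induction xs)
  case (Cons a xs)
  then show ?case by (subst queries.simps, subst list.sel, subst queries_hd_tl) simp
qed simp

lemma set_answers: "y \<in> carrier_mat n n \<Longrightarrow> set (answers y k) \<subseteq> carrier_vec n"
  by (induction k) (auto intro: carrier_vecI)

text \<open>Queries are functions of earlier answers, so equal answers mean equal queries. The
  pending head is excluded because its value has not been recorded.\<close>

lemma agree_on_queries:
  assumes "answers y k = answers y' k" "y *\<^sub>v v = y' *\<^sub>v v" "u \<in> set (tl (queries (answers y k)))"
  shows "y *\<^sub>v u = y' *\<^sub>v u"
  using assms
proof (induction k)
  case (Suc k)
  then have eq: "answers y k = answers y' k" and
    hd: "y *\<^sub>v hd (queries (answers y k)) = y' *\<^sub>v hd (queries (answers y k))" by auto
  have "u \<in> set (queries (answers y k))" using Suc.prems by simp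
  then have "u = hd (queries (answers y k)) \<or> u \<in> set (tl (queries (answers y k)))"
    by (subst (asm) queries_hd_tl) simp
  then show ?case using Suc.IH[OF eq Suc.prems(2)] hd by auto
qed auto

text \<open>Translation by the vector z applied to the pending query embeds the bad answers into the
  span of all queries so far; the 2 accounts for \<open>c\<close> and \<open>v\<close>.\<close>

lemma card_stops:
  assumes "set xs \<subseteq> carrier_vec n"
  shows "card (stops xs \<inter> carrier_vec n) \<le> card (UNIV :: 'a set) ^ (length xs + 2)"
proof -
  let ?w = "z *\<^sub>v hd (queries xs)"
  have w: "?w \<in> carrier_vec n" using z by (intro carrier_vecI) simp
  have "inj_on (\<lambda>a. ?w - a) (carrier_vec n)"
    by (rule inj_onI) (use w in \<open>auto simp: vec_eq_iff\<close>)
  then have "inj_on (\<lambda>a. ?w - a) (stops xs \<inter> carrier_vec n)" by (rule inj_on_subset) simp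
  moreover have "(\<lambda>a. ?w - a) ` (stops xs \<inter> carrier_vec n) \<subseteq> span_list n (queries xs)"
    by (auto simp: stops_def)
  ultimately have "card (stops xs \<inter> carrier_vec n) \<le> card (span_list n (queries xs))"
    by (rule card_inj_on_le[OF _ _ card_span_list(1)])
  also have "\<dots> \<le> card (UNIV :: 'a set) ^ (length xs + 2)"
    using card_span_list(2)[of n "queries xs"] by simp
  finally show ?thesis .
qed

end

section \<open>Krylov independence as an invariant of the queries\<close>

definition krylov_upto :: "nat \<Rightarrow> 'a :: field mat \<Rightarrow> 'a vec \<Rightarrow> nat \<Rightarrow> 'a vec list \<Rightarrow> bool" where
  "krylov_upto n A v k us \<longleftrightarrow> hd us = act A (monom 1 k) v
    \<and> (\<forall>p. degree p \<le> k \<longrightarrow> act A p v \<in> span_list n us)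
    \<and> (\<forall>p. p \<noteq> 0 \<longrightarrow> degree p \<le> k \<longrightarrow> act A p v \<noteq> 0\<^sub>v n)"

lemma act_monom_Suc:
  fixes A :: "'a :: field mat"
  assumes A: "A \<in> carrier_mat n n" and v: "v \<in> carrier_vec n"
  shows "act A (monom 1 (Suc k)) v = A *\<^sub>v act A (monom 1 k) v"
proof -
  have "0 \<cdot>\<^sub>v v + w = w" if "w \<in> carrier_vec n" for w using that v by (intro eq_vecI) auto
  then show ?thesis
    using mult_mat_vec_closed[OF A act_closed[OF A v]] by (simp add: monom_Suc act_pCons[OF A v])
qed

lemma krylov_upto_0:
  fixes A :: "'a :: field mat"
  assumes A: "A \<in> carrier_mat n n" and v: "v \<in> carrier_vec n" "v \<noteq> 0\<^sub>v n"
  shows "krylov_upto n A v 0 [v]"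
proof -
  have const: "act A [:a:] v = a \<cdot>\<^sub>v v + 0\<^sub>v n" for a
    using act_pCons[OF A v(1), of a 0] by (simp add: act_0[OF A v(1)] mult_mat_vec_zero[OF A])
  have "a \<cdot>\<^sub>v v + 0\<^sub>v n \<in> span_list n [v]" for a by auto
  moreover have "a = 0" if "a \<cdot>\<^sub>v v + 0\<^sub>v n = 0\<^sub>v n" for a
  proof (rule ccontr)
    assume "a \<noteq> 0"
    obtain i where "i < n" "v $ i \<noteq> 0" using v by (auto simp: vec_eq_iff)
    moreover have "(a \<cdot>\<^sub>v v + 0\<^sub>v n) $ i = 0\<^sub>v n $ i" using that by simp
    ultimately show False using v \<open>a \<noteq> 0\<close> by simp
  qed
  moreover have "act A 1 v = v" by (rule act_1[OF A v(1)])
  ultimately show ?thesis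
    unfolding krylov_upto_def by (auto simp: const monom_0 v(1) elim!: degree_eq_zeroE)
qed

text \<open>Split off the top coefficient of \<open>p\<close>. If it is nonzero and p(A) v = 0, the
  new iterate would be a multiple of a polynomial of degree at most k applied to \<open>v\<close>,
  hence in the span of \<open>us\<close>.\<close>

lemma krylov_upto_Suc:
  fixes A :: "'a :: field mat"
  assumes A: "A \<in> carrier_mat n n" and v: "v \<in> carrier_vec n"
    and us: "set us \<subseteq> carrier_vec n" and k: "krylov_upto n A v k us"
    and new: "A *\<^sub>v hd us \<notin> span_list n us"
  shows "krylov_upto n A v (Suc k) (A *\<^sub>v hd us # us)"
proof -
  define w where "w = A *\<^sub>v hd us"
  have w: "w = act A (monom 1 (Suc k)) v"
    using k by (simp add: w_def krylov_upto_def act_monom_Suc[OF A v])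
  have wc: "w \<in> carrier_vec n" unfolding w by (rule act_closed[OF A v])
  have split: "\<exists>p'. degree p' \<le> k \<and> p = Polynomial.smult (coeff p (Suc k)) (monom 1 (Suc k)) + p'
      \<and> act A p v = coeff p (Suc k) \<cdot>\<^sub>v w + act A p' v"
    if p: "degree p \<le> Suc k" for p
  proof (intro exI conjI)
    let ?m = "Polynomial.smult (coeff p (Suc k)) (monom 1 (Suc k))"
    show "degree (p - ?m) \<le> k"
    proof (rule degree_le, intro allI impI)
      fix i assume "k < i"
      then show "coeff (p - ?m) i = 0"
        using p by (cases "i = Suc k") (auto simp: coeff_eq_0)
    qed
    show p_eq: "p = ?m + (p - ?m)" by simp
    have "act A p v = act A (?m + (p - ?m)) v" by (subst p_eq) (rule refl)
    also have "\<dots> = coeff p (Suc k) \<cdot>\<^sub>v w + act A (p - ?m) v"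
      by (simp only: act_add[OF A v] act_smult[OF A v] w)
    finally show "act A p v = coeff p (Suc k) \<cdot>\<^sub>v w + act A (p - ?m) v" .
  qed
  have "act A p v \<in> span_list n (w # us)" if p: "degree p \<le> Suc k" for p
  proof -
    obtain p' where "degree p' \<le> k" "act A p v = coeff p (Suc k) \<cdot>\<^sub>v w + act A p' v"
      using split[OF p] by blast
    moreover from this have "act A p' v \<in> span_list n us" using k by (simp add: krylov_upto_def)
    ultimately show ?thesis using span_list_ConsI by metis
  qed
  moreover have "act A p v \<noteq> 0\<^sub>v n" if p: "degree p \<le> Suc k" "p \<noteq> 0" for p
  proof
    assume 0: "act A p v = 0\<^sub>v n"
    obtain p' where p': "degree p' \<le> k" "p = Polynomial.smult (coeff p (Suc k)) (monom 1 (Suc k)) + p'"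
      "act A p v = coeff p (Suc k) \<cdot>\<^sub>v w + act A p' v" using split[OF p(1)] by blast
    let ?c = "coeff p (Suc k)" and ?x = "act A p' v"
    have xc: "?x \<in> carrier_vec n" by (rule act_closed[OF A v])
    have eq: "?c * w $ i + ?x $ i = 0" if "i < n" for i
    proof -
      have "(?c \<cdot>\<^sub>v w + ?x) $ i = 0\<^sub>v n $ i" using p'(3) 0 by simp
      then show ?thesis using that wc xc by simp
    qed
    show False
    proof (cases "?c = 0")
      case True
      then have "p' = p" using p'(2) by simp
      then show False using 0 k p' p unfolding krylov_upto_def by blast
    next
      case False
      have "w = (- 1 / ?c) \<cdot>\<^sub>v ?x"
      proof (rule eq_vecI)
        fix i assume "i < dim_vec ((- 1 / ?c) \<cdot>\<^sub>v ?x)"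
        then have i: "i < n" using xc by simp
        have "?x $ i = - (?c * w $ i)" using eq[OF i] by (simp only: add_eq_0_iff)
        then show "w $ i = ((- 1 / ?c) \<cdot>\<^sub>v ?x) $ i"
          using i xc False by (simp only: index_smult_vec carrier_vecD) simp
      qed (use wc xc in simp)
      moreover have "?x \<in> span_list n us" using k p'(1) by (simp add: krylov_upto_def)
      ultimately show False using span_list_smult[OF us] new w_def by metis
    qed
  qed
  ultimately show ?thesis
    unfolding krylov_upto_def using w by (simp add: w_def[symmetric])
qed

lemma card_le_fibers:
  assumes "finite A" "finite B" "f ` A \<subseteq> B" "\<And>b. b \<in> B \<Longrightarrow> card {a \<in> A. f a = b} \<le> k"
  shows "card A \<le> k * card B"
proof -
  have "A = (\<Union>b\<in>B. {a \<in> A. f a = b})" using assms(3) by auto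
  then have "card A \<le> (\<Sum>b\<in>B. card {a \<in> A. f a = b})"
    using card_UN_le[OF assms(2), of "\<lambda>b. {a \<in> A. f a = b}"] by simp
  also have "\<dots> \<le> (\<Sum>b\<in>B. k)" by (rule sum_mono) (rule assms(4))
  finally show ?thesis by (simp add: mult.commute)
qed

lemma (in adaptive_queries) krylov_upto_queries:
  assumes y: "y \<in> carrier_mat n n" and c: "c = (z - y) *\<^sub>v v"
    and "\<not> hits stops (answers y k)" "k + 2 \<le> n"
  shows "krylov_upto n (z - y) v (Suc k) (queries (answers y k))"
  using assms(3,4)
proof (induction k)
  case 0
  have zy: "z - y \<in> carrier_mat n n" by (rule minus_carrier_mat[OF y])
  have v: "v \<in> carrier_vec n" "v \<noteq> 0\<^sub>v n" and cv: "c \<notin> span_list n [v]"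
    using indep by (simp_all only: lin_indep.simps span_list.simps) auto
  have "(z - y) *\<^sub>v hd [v] \<notin> span_list n [v]" using cv by (simp only: c list.sel not_False_eq_True)
  then have "krylov_upto n (z - y) v (Suc 0) ((z - y) *\<^sub>v hd [v] # [v])"
    by (intro krylov_upto_Suc[OF zy v(1) _ krylov_upto_0[OF zy v]]) (use v in auto)
  then show ?case by (simp add: c[symmetric])
next
  case (Suc k)
  let ?us = "queries (answers y k)"
  have zy: "z - y \<in> carrier_mat n n" by (rule minus_carrier_mat[OF y])
  have us: "set ?us \<subseteq> carrier_vec n"
    by (rule lin_indep_carrier[OF lin_indep_queries]) (use Suc.prems in simp)
  have v: "v \<in> carrier_vec n" using indep by simp
  have hd: "hd ?us \<in> carrier_vec n" using us by (subst (asm) queries_hd_tl) simp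
  have eq: "z *\<^sub>v hd ?us - y *\<^sub>v hd ?us = (z - y) *\<^sub>v hd ?us"
    by (rule minus_mult_distrib_mat_vec[OF z y hd, symmetric])
  have new: "(z - y) *\<^sub>v hd ?us \<notin> span_list n ?us"
    using Suc.prems by (simp add: stops_def eq)
  have "(z - y) *\<^sub>v hd ?us \<in> carrier_vec n" using zy hd by simp
  \<comment> \<open>Without a stop the fallback choice is never taken, so the next query is the next
    iterate of \<open>v\<close> under z - y.\<close>
  then have "next_query ?us (y *\<^sub>v hd ?us) = (z - y) *\<^sub>v hd ?us"
    using new by (simp add: next_query_def eq)
  then show ?case
    using krylov_upto_Suc[OF zy v us Suc.IH new] Suc.prems by simp
qed

section \<open>Upper bounds for the matrices with eigenvector v\<close>

context linear_times_irreducible_class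
begin

text \<open>With \<open>v\<close>, the answers fix y on n - 1 vectors of a basis, so two candidates
  differ by b r^T with r dual to the last query u. Equal characteristic polynomials make r vanish on
  the Krylov space of b under \<open>y1\<close>. If b were off the line of v, this space together
  with v would span u, contradicting r.u = 1. So b is one of the q multiples of v.\<close>

lemma card_Yv_answers_le:
  assumes "adaptive_queries n z c v"
  shows "card {y \<in> Yv v. adaptive_queries.answers n z c v y (n - 2) = xs} \<le> q"
proof (cases "{y \<in> Yv v. adaptive_queries.answers n z c v y (n - 2) = xs} = {}")
  case False
  interpret adaptive_queries n z c v by fact
  from False obtain y1 where y1: "y1 \<in> Yv v" "answers y1 (n - 2) = xs" by blast
  have yc: "y \<in> carrier_mat n n" and yv: "y *\<^sub>v v = l \<cdot>\<^sub>v v" and yY: "y \<in> Ys"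
    if "y \<in> Yv v" for y using that by (auto simp: Yv_def Ys_def)
  have len: "length xs + 2 = n" using y1(2) length_answers[of y1 "n - 2"] n by simp
  have v: "v \<in> carrier_vec n" "v \<noteq> 0\<^sub>v n" using indep by auto
  define u us where "u = hd (queries xs)" and "us = tl (queries xs)"
  have uus: "queries xs = u # us" unfolding u_def us_def by (rule queries_hd_tl)
  have "lin_indep n (u # us)" using lin_indep_queries[of xs] len uus by simp
  moreover have "length (u # us) = n" using length_queries[of xs] len uus by simp
  ultimately obtain r where r: "r \<in> carrier_vec n" "r \<bullet> u = 1" "\<forall>w\<in>set us. r \<bullet> w = 0"
    "\<forall>D\<in>carrier_mat n n. (\<forall>w\<in>set us. D *\<^sub>v w = 0\<^sub>v n) \<longrightarrow> D = outer (D *\<^sub>v u) r"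
    by (rule lin_indep_dual_vec)
  have uc: "u \<in> carrier_vec n" using lin_indep_queries[of xs] len uus by simp
  have usc: "set us \<subseteq> carrier_vec n"
    using lin_indep_carrier[OF lin_indep_queries[of xs]] len uus by simp
  have rv: "r \<bullet> v = 0" using r(3) v_in_tl_queries[of xs] by (simp add: us_def)
  have "{y \<in> Yv v. answers y (n - 2) = xs} \<subseteq> (\<lambda>t. y1 - outer (t \<cdot>\<^sub>v v) r) ` UNIV"
  proof
    fix y assume "y \<in> {y \<in> Yv v. answers y (n - 2) = xs}"
    then have y: "y \<in> Yv v" "answers y (n - 2) = xs" by auto
    let ?D = "y1 - y"
    have D: "?D \<in> carrier_mat n n" by (rule minus_carrier_mat[OF yc[OF y(1)]])
    define b where "b = ?D *\<^sub>v u"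
    have bc: "b \<in> carrier_vec n" unfolding b_def by (rule mult_mat_vec_carrier[OF D uc])
    have "?D *\<^sub>v w = 0\<^sub>v n" if w: "w \<in> set us" for w
    proof -
      have "y1 *\<^sub>v w = y *\<^sub>v w"
        by (rule agree_on_queries[of y1 "n - 2" y])
          (use y1 y w yv in \<open>simp_all add: us_def\<close>)
      moreover have "w \<in> carrier_vec n" using w usc by auto
      ultimately show ?thesis
        using minus_mult_distrib_mat_vec[OF yc[OF y1(1)] yc[OF y(1)], of w]
          mult_mat_vec_carrier[OF yc[OF y(1)], of w] by simp
    qed
    then have Do: "?D = outer b r" unfolding b_def using r(4) D by blast
    have y_eq: "y = y1 - outer b r"
      unfolding Do[symmetric] using yc[OF y1(1)] yc[OF y(1)] by (intro eq_matI) auto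
    have "\<exists>t. b = t \<cdot>\<^sub>v v"
    proof (rule ccontr)
      assume nt: "\<nexists>t. b = t \<cdot>\<^sub>v v"
      interpret y1: linear_times_irreducible y1 n l h by (rule Ys_locale[OF yY[OF y1(1)]])
      have cp: "char_poly (y1 - outer b r) = char_poly y1"
        using yY[OF y(1)] y1.cp y_eq by (simp add: Ys_def)
      obtain t p where u: "u = t \<cdot>\<^sub>v v + act y1 p b"
        by (rule y1.span_eigenvector[OF v yv[OF y1(1)] bc _ uc]) (use nt in blast)
      have "r \<bullet> u = t * (r \<bullet> v) + r \<bullet> act y1 p b"
        unfolding u using r(1) v bc act_closed[OF y1.y bc, of p]
        by (simp add: scalar_prod_add_distrib[of _ n] scalar_prod_smult_distrib[OF r(1) v(1)])
      also have "\<dots> = 0"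
        using rv scalar_act_eq_0_if_char_poly_eq[OF y1.y bc r(1) cp] by simp
      finally show False using r(2) by simp
    qed
    then show "y \<in> (\<lambda>t. y1 - outer (t \<cdot>\<^sub>v v) r) ` UNIV" using y_eq by blast
  qed
  then have "card {y \<in> Yv v. answers y (n - 2) = xs} \<le> card ((\<lambda>t. y1 - outer (t \<cdot>\<^sub>v v) r) ` UNIV)"
    by (rule card_mono[rotated]) simp
  also have "\<dots> \<le> q" unfolding q by (rule card_image_le) simp
  finally show ?thesis .
next
  case True
  show ?thesis by (simp only: True card.empty le0)
qed

lemma card_Yv_le:
  assumes v: "v \<in> carrier_vec n" "v \<noteq> 0\<^sub>v n"
  shows "card (Yv v) \<le> q * q ^ (n * (n - 2))"
proof -
  obtain c where c: "c \<in> carrier_vec n" "c \<notin> span_list n [v]"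
    using exists_not_in_span[of "[v]" n] n by auto
  \<comment> \<open>The fibre bound holds for every query strategy, so any matrix may steer the
    queries and any vector off the line of \<open>v\<close> may start them.\<close>
  interpret adaptive_queries n "1\<^sub>m n" c v
    by unfold_locales (use c v in auto)
  let ?B = "{xs :: 'a vec list. set xs \<subseteq> carrier_vec n \<and> length xs = n - 2}"
  have "card (Yv v) \<le> q * card ?B"
  proof (rule card_le_fibers)
    show "(\<lambda>y. answers y (n - 2)) ` Yv v \<subseteq> ?B"
    proof
      fix xs assume "xs \<in> (\<lambda>y. answers y (n - 2)) ` Yv v"
      then obtain y where "y \<in> Yv v" "xs = answers y (n - 2)" by auto
      then show "xs \<in> ?B" using set_answers[of y "n - 2"] by (auto simp: Yv_def Ys_def)
    qed
    show "card {y \<in> Yv v. answers y (n - 2) = xs} \<le> q" for xs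
      by (rule card_Yv_answers_le) (rule adaptive_queries_axioms)
  qed (auto intro: finite_lists_length_eq)
  also have "card ?B = q ^ (n * (n - 2))"
    using card_lists_length_eq[of "carrier_vec n :: 'a vec set" "n - 2"]
    by (simp add: card_carrier_vec q power_mult)
  finally show ?thesis .
qed

text \<open>If no answer stops the sequence, v and its first n - 1 iterates under z - y are
  independent and \<open>v\<close> is cyclic. So a \<open>y\<close> counted here has a list of
  answers that hits \<open>stops\<close>, and each list belongs to at most q matrices.\<close>

lemma card_Yv_not_cyclic_le:
  assumes z: "z \<in> carrier_mat n n" and v: "v \<in> carrier_vec n" "v \<noteq> 0\<^sub>v n"
    and noneig: "\<And>t. z *\<^sub>v v \<noteq> t \<cdot>\<^sub>v v"
  shows "(q - 1) * card {y \<in> Yv v. \<not> cyclic_vec (z - y) v} \<le> q * q ^ (n * (n - 2))"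
proof -
  \<comment> \<open>The first iterate (z - y) v, which is common to all y in \<open>Yv v\<close>. It
    is off the line of \<open>v\<close> because \<open>v\<close> is not an eigenvector of
    \<open>z\<close>.\<close>
  define c where "c = z *\<^sub>v v - l \<cdot>\<^sub>v v"
  have zv: "z *\<^sub>v v \<in> carrier_vec n" using z v by simp
  have cc: "c \<in> carrier_vec n" using zv v by (simp add: c_def)
  have "c \<noteq> t \<cdot>\<^sub>v v + 0\<^sub>v n" for t
  proof
    assume eq: "c = t \<cdot>\<^sub>v v + 0\<^sub>v n"
    have "z *\<^sub>v v = (t + l) \<cdot>\<^sub>v v"
    proof (rule eq_vecI)
      fix i assume "i < dim_vec ((t + l) \<cdot>\<^sub>v v)"
      then have i: "i < n" using v by simp
      have "c $ i = (t \<cdot>\<^sub>v v + 0\<^sub>v n) $ i" by (simp only: eq)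
      then show "(z *\<^sub>v v) $ i = ((t + l) \<cdot>\<^sub>v v) $ i"
        using i v zv z by (simp add: c_def algebra_simps)
    qed (use v z in simp)
    then show False using noneig by blast
  qed
  then have "c \<notin> span_list n [v]" by (auto simp del: right_zero_vec)
  then interpret adaptive_queries n z c v
    by unfold_locales (use z cc v in auto)
  let ?A = "{y \<in> Yv v. \<not> cyclic_vec (z - y) v}"
  let ?B = "{xs :: 'a vec list. set xs \<subseteq> carrier_vec n \<and> length xs = n - 2 \<and> hits stops xs}"
  have "card ?A \<le> q * card ?B"
  proof (rule card_le_fibers)
    show "(\<lambda>y. answers y (n - 2)) ` ?A \<subseteq> ?B"
    proof
      fix xs assume "xs \<in> (\<lambda>y. answers y (n - 2)) ` ?A"
      then obtain y where y: "y \<in> Yv v" "\<not> cyclic_vec (z - y) v" and xs: "xs = answers y (n - 2)" by auto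
      have yc: "y \<in> carrier_mat n n" and yv: "y *\<^sub>v v = l \<cdot>\<^sub>v v" using y by (auto simp: Yv_def Ys_def)
      have zy: "z - y \<in> carrier_mat n n" by (rule minus_carrier_mat[OF yc])
      have "hits stops xs"
      proof (rule ccontr)
        assume "\<not> hits stops xs"
        moreover have "c = (z - y) *\<^sub>v v"
          using minus_mult_distrib_mat_vec[OF z yc v(1)] yv by (simp add: c_def)
        ultimately have k: "krylov_upto n (z - y) v (Suc (n - 2)) (queries xs)"
          using krylov_upto_queries[OF yc, of "n - 2"] n xs by simp
        have "p = 0 \<or> n \<le> degree p" if "act (z - y) p v = 0\<^sub>v n" for p
        proof (rule ccontr)
          assume "\<not> (p = 0 \<or> n \<le> degree p)"
          then have "p \<noteq> 0" "degree p \<le> Suc (n - 2)" using n by auto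
          then show False using k that unfolding krylov_upto_def by blast
        qed
        then show False using y(2) cyclic_vec_iff[OF zy v(1)] by blast
      qed
      then show "xs \<in> ?B" using set_answers[OF yc, of "n - 2"] xs by simp
    qed
    show "card {y \<in> ?A. answers y (n - 2) = xs} \<le> q" for xs
    proof -
      have "card {y \<in> ?A. answers y (n - 2) = xs} \<le> card {y \<in> Yv v. answers y (n - 2) = xs}"
        by (rule card_mono) auto
      also have "\<dots> \<le> q" by (rule card_Yv_answers_le) (rule adaptive_queries_axioms)
      finally show ?thesis .
    qed
    show "finite ?B"
      by (rule finite_subset[OF _ finite_lists_length_eq[OF finite_carrier_vec, of n "n - 2"]]) auto
  qed simp
  then have A: "(q - 1) * card ?A \<le> q * ((q - 1) * card ?B)"
    using mult_le_mono2[of "card ?A" "q * card ?B" "q - 1"] by (simp only: mult_ac)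
  \<comment> \<open>Lists of length n - 2 with offset 2 give the factor q^n on the right, which
    cancels the size of F^n on the left.\<close>
  have "(q - 1) * q ^ n * card ?B \<le> (q ^ n) ^ (n - 2) * q ^ (n - 2 + 2)"
    using card_hits[OF finite_carrier_vec, of q n stops 2 "n - 2"] card_stops card_field_ge_2[where 'a = 'a]
    by (simp add: card_carrier_vec q)
  then have "q ^ n * ((q - 1) * card ?B) \<le> q ^ n * q ^ (n * (n - 2))"
  proof -
    have "n - 2 + 2 = n" using n by simp
    then have "q ^ (n - 2 + 2) = q ^ n" by (simp only:)
    moreover have "(q ^ n) ^ (n - 2) = q ^ (n * (n - 2))" by (simp only: power_mult)
    ultimately show ?thesis using \<open>(q - 1) * q ^ n * card ?B \<le> _\<close> by (simp only: mult_ac)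
  qed
  moreover have "q ^ n > 0" using card_field_ge_2[where 'a = 'a] by (simp add: q)
  ultimately have "(q - 1) * card ?B \<le> q ^ (n * (n - 2))" by (rule mult_left_le_imp_le)
  then show ?thesis using A mult_le_mono2[of _ _ q] le_trans by blast
qed

end

section \<open>Lower bound for the size of Y by counting bases\<close>

lemma lin_indep_rev_inverse:
  fixes us :: "'a :: field vec list"
  assumes us: "lin_indep n us" "length us = n"
  obtains P' where "P' \<in> carrier_mat n n" "mat_of_cols n (rev us) * P' = 1\<^sub>m n"
    "P' * mat_of_cols n (rev us) = 1\<^sub>m n"
proof -
  let ?P = "mat_of_cols n (rev us)"
  have P: "?P \<in> carrier_mat n n" by (rule carrier_matI) (use us in auto)
  have "det ?P \<noteq> 0"
  proof
    assume "det ?P = 0"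
    then obtain a where a: "a \<in> carrier_vec n" "a \<noteq> 0\<^sub>v n" "?P *\<^sub>v a = 0\<^sub>v n"
      using det_0_iff_vec_prod_zero_field[OF P] by blast
    let ?a = "vec n (\<lambda>i. a $ (n - Suc i))"
    have "mat_of_cols n us *\<^sub>v ?a = ?P *\<^sub>v a"
    proof (rule eq_vecI)
      fix i assume "i < dim_vec (?P *\<^sub>v a)"
      then have i: "i < n" by simp
      have "(mat_of_cols n us *\<^sub>v ?a) $ i = (\<Sum>j<n. us ! j $ i * a $ (n - Suc j))"
        using i us by (simp add: scalar_prod_def mat_of_cols_index atLeast0LessThan)
      also have "\<dots> = (\<Sum>j<n. us ! (n - Suc j) $ i * a $ (n - Suc (n - Suc j)))"
        by (rule sum.nat_diff_reindex[symmetric])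
      also have "\<dots> = (?P *\<^sub>v a) $ i"
        using i us a(1) by (simp add: scalar_prod_def mat_of_cols_index atLeast0LessThan rev_nth)
      finally show "(mat_of_cols n us *\<^sub>v ?a) $ i = (?P *\<^sub>v a) $ i" .
    qed simp
    then have "?a = 0\<^sub>v n" using mat_of_cols_mult_eq_0[OF us(1), of ?a] us(2) a(3) by simp
    then have a0: "?a $ (n - Suc i) = 0" if "i < n" for i using that by simp
    have "a $ i = 0" if "i < n" for i
    proof -
      have "n - Suc (n - Suc i) = i" "n - Suc i < n" using that by arith+
      then show ?thesis using a0[OF that] by simp
    qed
    then show False using a by (auto intro!: eq_vecI)
  qed
  then show ?thesis using det_nonzero_inverse[OF P] that by blast
qed

lemma poly_of_unit_vec:
  "i < n \<Longrightarrow> poly_of n (unit_vec n i) = monom 1 i"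
  by (intro poly_eqI) (auto simp: coeff_poly_of)

text \<open>Conjugate \<open>y0\<close> by the base change \<open>G\<close> that carries its Krylov
  basis to \<open>us\<close> read from the end. The list is newest first and Krylov columns are
  oldest first, hence the reversal.\<close>

lemma similar_shift_basis:
  fixes y0 :: "'a :: field mat"
  assumes y0: "y0 \<in> carrier_mat n n" "c \<in> carrier_vec n" "cyclic_vec y0 c"
    and us: "lin_indep n us" "length us = n"
  obtains y where "y \<in> carrier_mat n n" "similar_mat y y0" "\<And>j. Suc j < n \<Longrightarrow> y *\<^sub>v us ! Suc j = us ! j"
proof -
  let ?P = "mat_of_cols n (rev us)" and ?K = "krylov_mat y0 c"
  obtain P' where P': "P' \<in> carrier_mat n n" "?P * P' = 1\<^sub>m n" "P' * ?P = 1\<^sub>m n"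
    by (rule lin_indep_rev_inverse[OF us])
  have P: "?P \<in> carrier_mat n n" by (rule carrier_matI) (use us in auto)
  have K: "?K \<in> carrier_mat n n" using krylov_mat_carrier[OF y0(1,2)] .
  obtain K' where K': "K' \<in> carrier_mat n n" "?K * K' = 1\<^sub>m n" "K' * ?K = 1\<^sub>m n"
    using det_nonzero_inverse[OF K det_krylov_mat[OF y0]] by blast
  define G G' where "G = ?P * K'" and "G' = ?K * P'"
  have G: "G \<in> carrier_mat n n" "G' \<in> carrier_mat n n" using P P' K K' by (auto simp: G_def G'_def)
  have cancel: "(A * B) * (B' * A') = 1\<^sub>m n"
    if c: "A \<in> carrier_mat n n" "B \<in> carrier_mat n n" "B' \<in> carrier_mat n n" "A' \<in> carrier_mat n n"
      and i: "A * A' = 1\<^sub>m n" "B * B' = 1\<^sub>m n" for A B A' B' :: "'a mat"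
  proof -
    have "(A * B) * (B' * A') = A * ((B * B') * A')"
      using c by (simp add: assoc_mult_mat[of _ n n _ n _ n])
    then show ?thesis using c i by simp
  qed
  have GG: "G * G' = 1\<^sub>m n" "G' * G = 1\<^sub>m n"
    unfolding G_def G'_def using cancel P P' K K' by auto
  define y where "y = G * y0 * G'"
  have y: "y \<in> carrier_mat n n" using G y0 by (simp add: y_def)
  have sim: "similar_mat y y0"
    by (rule similar_matI[of _ _ G G' n]) (use y y0 G GG in \<open>auto simp: y_def\<close>)
  have e: "unit_vec n i \<in> carrier_vec n" for i by simp
  have Pe: "?P *\<^sub>v unit_vec n i = us ! (n - Suc i)" if "i < n" for i
    using mat_of_cols_unit_vec[of "rev us" n i] lin_indep_carrier[OF us(1)] us(2) that by (simp add: rev_nth)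
  have Ke: "?K *\<^sub>v unit_vec n i = act y0 (monom 1 i) c" if "i < n" for i
    by (simp only: krylov_mat_mult[OF y0(1,2) e] poly_of_unit_vec[OF that])
  have "y *\<^sub>v us ! Suc j = us ! j" if j: "Suc j < n" for j
  proof -
    define i where "i = n - Suc (Suc j)"
    have i: "Suc i < n" "n - Suc i = Suc j" "n - Suc (Suc i) = j" using j by (auto simp: i_def)
    have "y *\<^sub>v us ! Suc j = y *\<^sub>v (?P *\<^sub>v unit_vec n i)" using Pe[of i] i by simp
    also have "\<dots> = G *\<^sub>v (y0 *\<^sub>v (?K *\<^sub>v (P' *\<^sub>v (?P *\<^sub>v unit_vec n i))))"
    proof -
      have w: "?P *\<^sub>v unit_vec n i \<in> carrier_vec n" by (rule mult_mat_vec_carrier[OF P e])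
      show ?thesis
        unfolding y_def assoc_mult_mat_vec[OF mult_carrier_mat[OF G(1) y0(1)] G(2) w]
          assoc_mult_mat_vec[OF G(1) y0(1) mult_mat_vec_carrier[OF G(2) w]]
        unfolding G'_def assoc_mult_mat_vec[OF K P'(1) w] ..
    qed
    also have "P' *\<^sub>v (?P *\<^sub>v unit_vec n i) = unit_vec n i"
      using assoc_mult_mat_vec[OF P'(1) P e[of i]] P'(3) by simp
    also have "y0 *\<^sub>v (?K *\<^sub>v unit_vec n i) = ?K *\<^sub>v unit_vec n (Suc i)"
      using i by (simp add: Ke act_monom_Suc[OF y0(1,2)])
    also have "G *\<^sub>v (?K *\<^sub>v unit_vec n (Suc i)) = ?P *\<^sub>v (K' *\<^sub>v (?K *\<^sub>v unit_vec n (Suc i)))"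
      unfolding G_def by (rule assoc_mult_mat_vec) (use P K K' in auto)
    also have "K' *\<^sub>v (?K *\<^sub>v unit_vec n (Suc i)) = unit_vec n (Suc i)"
      using assoc_mult_mat_vec[OF K'(1) K e[of "Suc i"]] K'(3) by simp
    also have "?P *\<^sub>v unit_vec n (Suc i) = us ! j" using Pe[of "Suc i"] i by simp
    finally show ?thesis .
  qed
  then show ?thesis using that[OF y sim] by blast
qed

text \<open>Each way of extending \<open>e\<close> to a basis, as a list of n - 1 further vectors,
  yields an element of \<open>Ys\<close> whose iterates of \<open>e\<close> run through that list.
  The matrix determines the list, so \<open>Ys\<close> is at least as large as the set of such
  lists.\<close>

lemma (in linear_times_irreducible_class) card_Ys_ge:
  assumes y0: "y0 \<in> Ys"
  shows "(q - 1) * (q ^ n) ^ (n - 1) \<le> (q - 1) * card Ys + (q ^ n) ^ (n - 1)"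
proof -
  interpret y0: linear_times_irreducible y0 n l h by (rule Ys_locale[OF y0])
  obtain v u where vu: "v \<in> carrier_vec n" "u \<in> carrier_vec n" "cyclic_vec y0 (v + u)"
    by (rule y0.exists_basis_vectors)
  define e where "e = (unit_vec n 0 :: 'a vec)"
  have e: "e \<in> carrier_vec n" "e \<noteq> 0\<^sub>v n" using n by (auto simp: e_def)
  \<comment> \<open>The next vector is bad if it lies in the span of the earlier ones and
    \<open>e\<close>, which sits at the end of the list as its oldest entry.\<close>
  define T where "T xs = span_list n (xs @ [e])" for xs
  define L where "L = {xs :: 'a vec list. set xs \<subseteq> carrier_vec n \<and> length xs = n - 1}"
  define H where "H = {xs :: 'a vec list. set xs \<subseteq> carrier_vec n \<and> length xs = n - 1 \<and> hits T xs}"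
  have L: "finite L" "card L = (q ^ n) ^ (n - 1)"
    using finite_lists_length_eq[of "carrier_vec n :: 'a vec set"]
      card_lists_length_eq[of "carrier_vec n :: 'a vec set" "n - 1"]
    by (auto simp: L_def card_carrier_vec q)
  have li: "lin_indep n (xs @ [e])" if "set xs \<subseteq> carrier_vec n" "\<not> hits T xs" for xs
    using that by (induction xs) (use e in \<open>auto simp: T_def\<close>)
  have "\<exists>y. y \<in> Ys \<and> (\<forall>j. Suc j < n \<longrightarrow> y *\<^sub>v (xs @ [e]) ! Suc j = (xs @ [e]) ! j)"
    if xs: "xs \<in> L - H" for xs
  proof -
    have xs': "set xs \<subseteq> carrier_vec n" "\<not> hits T xs" "length xs = n - 1"
      using xs by (auto simp: L_def H_def)
    have vuc: "v + u \<in> carrier_vec n" using vu by simp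
    have len: "length (xs @ [e]) = n" using xs' n by simp
    obtain y where y: "y \<in> carrier_mat n n" "similar_mat y y0"
      "\<And>j. Suc j < n \<Longrightarrow> y *\<^sub>v (xs @ [e]) ! Suc j = (xs @ [e]) ! j"
      by (rule similar_shift_basis[OF y0.y vuc vu(3) li[OF xs'(1,2)] len]) blast
    then show ?thesis using char_poly_similar[OF y(2)] y0.cp by (auto simp: Ys_def)
  qed
  then obtain F where F: "\<And>xs. xs \<in> L - H \<Longrightarrow> F xs \<in> Ys"
    "\<And>xs j. xs \<in> L - H \<Longrightarrow> Suc j < n \<Longrightarrow> F xs *\<^sub>v (xs @ [e]) ! Suc j = (xs @ [e]) ! j"
    by metis
  have "inj_on F (L - H)"
  proof (rule inj_onI)
    fix xs ys assume xs: "xs \<in> L - H" and ys: "ys \<in> L - H" and eq: "F xs = F ys"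
    have len: "length (xs @ [e]) = n" "length (ys @ [e]) = n" using xs ys n by (auto simp: L_def)
    \<comment> \<open>The i-th iterate of \<open>e\<close> stands at index n - 1 - i, so equal
      matrices reproduce both lists from the common last entry.\<close>
    have *: "i < n \<Longrightarrow> (xs @ [e]) ! (n - Suc i) = (ys @ [e]) ! (n - Suc i)" for i
    proof (induction i)
      case 0
      have "length xs = n - Suc 0" "length ys = n - Suc 0" using xs ys by (auto simp: L_def)
      then show ?case by (simp add: nth_append)
    next
      case (Suc i)
      then have "Suc (n - Suc (Suc i)) = n - Suc i" by simp
      then show ?case
        using F(2)[OF xs, of "n - Suc (Suc i)"] F(2)[OF ys, of "n - Suc (Suc i)"] Suc eq by simp
    qed
    have "xs @ [e] = ys @ [e]"
    proof (rule nth_equalityI)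
      fix j assume "j < length (xs @ [e])"
      then show "(xs @ [e]) ! j = (ys @ [e]) ! j" using *[of "n - Suc j"] len by simp
    qed (use len in simp)
    then show "xs = ys" by simp
  qed
  then have "card (L - H) \<le> card Ys"
    by (rule card_inj_on_le) (use F(1) in auto)
  moreover have "card L \<le> card (L - H) + card H"
  proof -
    have "(L - H) \<union> H = L" by (auto simp: L_def H_def)
    then show ?thesis using card_Un_le[of "L - H" H] by (simp only:)
  qed
  ultimately have "card L \<le> card Ys + card H" by linarith
  from mult_le_mono2[OF this, of "q - 1"]
  have "(q - 1) * card L \<le> (q - 1) * card Ys + (q - 1) * card H" by (simp only: distrib_left)
  moreover have "(q - 1) * card H \<le> (q ^ n) ^ (n - 1)"
  proof -
    have "card (T xs \<inter> carrier_vec n) \<le> q ^ (length xs + 1)" for xs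
    proof -
      have "card (T xs \<inter> carrier_vec n) \<le> card (T xs)"
        by (rule card_mono) (auto simp: T_def card_span_list(1))
      also have "\<dots> \<le> q ^ (length xs + 1)"
        using card_span_list(2)[of n "xs @ [e]"] by (simp add: T_def q)
      finally show ?thesis .
    qed
    moreover have "q \<ge> 1" using card_field_ge_2[where 'a = 'a] by (simp add: q)
    \<comment> \<open>Offset 1 for \<open>e\<close> and length n - 1 give the exponent n, so the
      size of F^n cancels again.\<close>
    ultimately have "(q - 1) * card (carrier_vec n :: 'a vec set) * card H
        \<le> card (carrier_vec n :: 'a vec set) ^ (n - 1) * q ^ (n - 1 + 1)"
      unfolding H_def by (intro card_hits finite_carrier_vec)
    then have "q ^ n * ((q - 1) * card H) \<le> q ^ n * (q ^ n) ^ (n - 1)"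
      using n by (simp add: card_carrier_vec q mult_ac)
    moreover have "q ^ n > 0" using \<open>q \<ge> 1\<close> by simp
    ultimately show ?thesis by (rule mult_left_le_imp_le)
  qed
  ultimately show ?thesis unfolding L(2) by linarith
qed

section \<open>Eigenvectors of a non-scalar matrix\<close>

lemma is_scalar_mat_if_all_eigenvectors:
  fixes z :: "'a :: comm_ring_1 mat"
  assumes z: "z \<in> carrier_mat n n" and n: "n > 0"
    and eig: "\<And>v. v \<in> carrier_vec n \<Longrightarrow> \<exists>t. z *\<^sub>v v = t \<cdot>\<^sub>v v"
  shows "is_scalar_mat n z"
proof -
  have off: "z $$ (i, j) = 0" if ij: "i < n" "j < n" "i \<noteq> j" for i j
  proof -
    obtain t where t: "z *\<^sub>v unit_vec n j = t \<cdot>\<^sub>v unit_vec n j" using eig[of "unit_vec n j"] by auto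
    have "(z *\<^sub>v unit_vec n j) $ i = (t \<cdot>\<^sub>v unit_vec n j) $ i" by (simp only: t)
    then show ?thesis using z ij by simp
  qed
  have diag: "z $$ (j, j) = z $$ (0, 0)" if j: "j < n" for j
  proof (cases "j = 0")
    case False
    let ?v = "unit_vec n 0 + unit_vec n j :: 'a vec"
    obtain t where t: "z *\<^sub>v ?v = t \<cdot>\<^sub>v ?v" using eig[of ?v] by auto
    have "z *\<^sub>v ?v = z *\<^sub>v unit_vec n 0 + z *\<^sub>v unit_vec n j"
      by (rule mult_add_distrib_mat_vec[OF z]) auto
    then have "(z *\<^sub>v unit_vec n 0 + z *\<^sub>v unit_vec n j) $ i = (t \<cdot>\<^sub>v ?v) $ i" for i by (simp only: t)
    from this[of 0] this[of j] show ?thesis using z j n False off[of 0 j] off[of j 0] by simp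
  qed simp
  have "z = z $$ (0, 0) \<cdot>\<^sub>m 1\<^sub>m n"
  proof (rule eq_matI)
    fix i j assume "i < dim_row (z $$ (0, 0) \<cdot>\<^sub>m 1\<^sub>m n)" "j < dim_col (z $$ (0, 0) \<cdot>\<^sub>m 1\<^sub>m n)"
    then show "z $$ (i, j) = (z $$ (0, 0) \<cdot>\<^sub>m 1\<^sub>m n) $$ (i, j)"
      using off[of i j] diag[of i] by (cases "i = j") auto
  qed (use z in auto)
  then show ?thesis unfolding is_scalar_mat_def by blast
qed

text \<open>Two eigenvectors on the line have distinct eigenvalues, as otherwise their difference, a
  multiple of \<open>u\<close>, would be an eigenvector. A third one would give the plane of the
  line three eigendirections, making \<open>z\<close> scalar there, against the choice of
  \<open>u\<close>. The computation carries this out by coordinates.\<close>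

lemma eigenvectors_on_line:
  fixes z :: "'a :: field mat"
  assumes z: "z \<in> carrier_mat n n" and v: "v \<in> carrier_vec n" and u: "u \<in> carrier_vec n"
    and noneig: "\<And>t. z *\<^sub>v u \<noteq> t \<cdot>\<^sub>v u"
    and d: "a \<noteq> b" "b \<noteq> c" "a \<noteq> c"
    and ev: "z *\<^sub>v (v + a \<cdot>\<^sub>v u) = \<alpha> \<cdot>\<^sub>v (v + a \<cdot>\<^sub>v u)" "z *\<^sub>v (v + b \<cdot>\<^sub>v u) = \<beta> \<cdot>\<^sub>v (v + b \<cdot>\<^sub>v u)"
      "z *\<^sub>v (v + c \<cdot>\<^sub>v u) = \<gamma> \<cdot>\<^sub>v (v + c \<cdot>\<^sub>v u)"
  shows False
proof -
  define V W where "V = z *\<^sub>v v" and "W = z *\<^sub>v u"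
  have VW: "V \<in> carrier_vec n" "W \<in> carrier_vec n" using z v u by (auto simp: V_def W_def)
  have comp: "V $ i + t * W $ i = s * (v $ i + t * u $ i)"
    if "z *\<^sub>v (v + t \<cdot>\<^sub>v u) = s \<cdot>\<^sub>v (v + t \<cdot>\<^sub>v u)" "i < n" for s t i
  proof -
    have "z *\<^sub>v (v + t \<cdot>\<^sub>v u) = V + t \<cdot>\<^sub>v W"
      unfolding V_def W_def using z v u by (simp add: mult_add_distrib_mat_vec[OF z] mult_mat_vec[OF z])
    then have "(V + t \<cdot>\<^sub>v W) $ i = (s \<cdot>\<^sub>v (v + t \<cdot>\<^sub>v u)) $ i" using that(1) by (simp only:)
    then show ?thesis using that(2) v u VW by simp
  qed
  have no: False if "k \<noteq> 0" "\<And>i. i < n \<Longrightarrow> k * W $ i = m * u $ i" for k m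
  proof -
    have "W = (m / k) \<cdot>\<^sub>v u"
      using that u VW by (intro eq_vecI) (auto simp: field_simps)
    then show False using noneig by (simp add: W_def)
  qed
  have ab: "(a - b) * W $ i = (\<alpha> - \<beta>) * v $ i + (\<alpha> * a - \<beta> * b) * u $ i" if "i < n" for i
  proof -
    have "(a - b) * W $ i = (V $ i + a * W $ i) - (V $ i + b * W $ i)" by (simp add: algebra_simps)
    also have "\<dots> = \<alpha> * (v $ i + a * u $ i) - \<beta> * (v $ i + b * u $ i)"
      by (simp only: comp[OF ev(1) that] comp[OF ev(2) that])
    finally show ?thesis by (simp add: algebra_simps)
  qed
  have ac: "(a - c) * W $ i = (\<alpha> - \<gamma>) * v $ i + (\<alpha> * a - \<gamma> * c) * u $ i" if "i < n" for i
  proof -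
    have "(a - c) * W $ i = (V $ i + a * W $ i) - (V $ i + c * W $ i)" by (simp add: algebra_simps)
    also have "\<dots> = \<alpha> * (v $ i + a * u $ i) - \<gamma> * (v $ i + c * u $ i)"
      by (simp only: comp[OF ev(1) that] comp[OF ev(3) that])
    finally show ?thesis by (simp add: algebra_simps)
  qed
  have \<alpha>\<beta>: "\<alpha> \<noteq> \<beta>" using no[of "a - b" "\<alpha> * a - \<beta> * b"] ab d by auto
  have \<alpha>\<gamma>: "\<alpha> \<noteq> \<gamma>" using no[of "a - c" "\<alpha> * a - \<gamma> * c"] ac d by auto
  \<comment> \<open>The coefficients left after eliminating \<open>v\<close> from \<open>ab\<close>
    and \<open>ac\<close>. A relation k W = m u forces both to vanish, and m - \<alpha> k is a
    product of three nonzero differences.\<close>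
  define k m where "k = (\<alpha> - \<gamma>) * (a - b) - (\<alpha> - \<beta>) * (a - c)"
    and "m = (\<alpha> - \<gamma>) * (\<alpha> * a - \<beta> * b) - (\<alpha> - \<beta>) * (\<alpha> * a - \<gamma> * c)"
  have km: "k * W $ i = m * u $ i" if "i < n" for i
  proof -
    have "k * W $ i = (\<alpha> - \<gamma>) * ((a - b) * W $ i) - (\<alpha> - \<beta>) * ((a - c) * W $ i)"
      by (simp add: k_def algebra_simps)
    then show ?thesis unfolding ab[OF that] ac[OF that] by (simp add: m_def algebra_simps)
  qed
  have k: "k = 0" using no[of k m] km by blast
  have m: "m = 0"
  proof (rule ccontr)
    assume "m \<noteq> 0"
    then have "u $ i = 0" if "i < n" for i using km[OF that] k by simp
    then have "u = 0\<^sub>v n" using u by (intro eq_vecI) auto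
    then show False using noneig[of 0] z by (auto simp: vec_eq_iff scalar_prod_def)
  qed
  have "(\<alpha> - \<gamma>) * (\<alpha> - \<beta>) * (b - c) = m - \<alpha> * k" by (simp add: k_def m_def algebra_simps)
  then have "(\<alpha> - \<gamma>) * (\<alpha> - \<beta>) * (b - c) = 0" by (simp add: k m)
  then show False using \<alpha>\<beta> \<alpha>\<gamma> d by simp
qed

text \<open>Average over all lines in the direction of a vector \<open>u\<close> that is not an
  eigenvector: each of them has q points, of which at most two are eigenvectors.\<close>

lemma card_eigenvectors_le:
  fixes z :: "'a :: {field, finite} mat"
  assumes z: "z \<in> carrier_mat n n" and n: "n > 0" and ns: "\<not> is_scalar_mat n z"
  shows "card (UNIV :: 'a set) * card {v \<in> carrier_vec n. \<exists>t. z *\<^sub>v v = t \<cdot>\<^sub>v v}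
    \<le> 2 * card (UNIV :: 'a set) ^ n"
proof -
  let ?E = "{v \<in> carrier_vec n. \<exists>t. z *\<^sub>v v = t \<cdot>\<^sub>v v}"
  obtain u where u: "u \<in> carrier_vec n" "\<And>t. z *\<^sub>v u \<noteq> t \<cdot>\<^sub>v u"
    using is_scalar_mat_if_all_eigenvectors[OF z n] ns by blast
  let ?S = "\<lambda>v. {t. v + t \<cdot>\<^sub>v u \<in> ?E}"
  have S: "card (?S v) \<le> 2" if v: "v \<in> carrier_vec n" for v
  proof (rule ccontr)
    assume "\<not> card (?S v) \<le> 2"
    then have "3 \<le> card (?S v)" by simp
    then obtain T where T: "T \<subseteq> ?S v" "card T = 3" by (meson obtain_subset_with_card_n)
    then obtain a b c where abc: "T = {a, b, c}" "a \<noteq> b" "b \<noteq> c" "a \<noteq> c" by (metis card_3_iff)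
    have ev: "\<exists>s. z *\<^sub>v (v + t \<cdot>\<^sub>v u) = s \<cdot>\<^sub>v (v + t \<cdot>\<^sub>v u)" if "t \<in> T" for t
      using that T(1) by auto
    obtain \<alpha> where "z *\<^sub>v (v + a \<cdot>\<^sub>v u) = \<alpha> \<cdot>\<^sub>v (v + a \<cdot>\<^sub>v u)" using ev[of a] abc(1) by auto
    moreover obtain \<beta> where "z *\<^sub>v (v + b \<cdot>\<^sub>v u) = \<beta> \<cdot>\<^sub>v (v + b \<cdot>\<^sub>v u)" using ev[of b] abc(1) by auto
    moreover obtain \<gamma> where "z *\<^sub>v (v + c \<cdot>\<^sub>v u) = \<gamma> \<cdot>\<^sub>v (v + c \<cdot>\<^sub>v u)" using ev[of c] abc(1) by auto
    ultimately show False by (rule eigenvectors_on_line[OF z v u(1) u(2) abc(2-4)])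
  qed
  have "card (?E \<times> (UNIV :: 'a set)) \<le> card (SIGMA v:carrier_vec n. ?S v)"
  proof (rule card_inj_on_le)
    have restore: "w + (- t) \<cdot>\<^sub>v u + t \<cdot>\<^sub>v u = w" if "w \<in> carrier_vec n" for w t
      using that u by (intro eq_vecI) auto
    show "inj_on (\<lambda>(w, t). (w + (- t) \<cdot>\<^sub>v u, t)) (?E \<times> UNIV)"
      by (rule inj_on_inverseI[of _ "\<lambda>(v, t). (v + t \<cdot>\<^sub>v u, t)"]) (auto simp only: restore split: prod.splits)
    show "(\<lambda>(w, t). (w + (- t) \<cdot>\<^sub>v u, t)) ` (?E \<times> UNIV) \<subseteq> (SIGMA v:carrier_vec n. ?S v)"
    proof
      fix p assume "p \<in> (\<lambda>(w, t). (w + (- t) \<cdot>\<^sub>v u, t)) ` (?E \<times> UNIV)"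
      then obtain w t where p: "p = (w + (- t) \<cdot>\<^sub>v u, t)" and w: "w \<in> ?E" by auto
      have "w + (- t) \<cdot>\<^sub>v u + t \<cdot>\<^sub>v u = w" using restore w by blast
      then have "t \<in> ?S (w + (- t) \<cdot>\<^sub>v u)" using w by (simp only: mem_Collect_eq)
      moreover have "w + (- t) \<cdot>\<^sub>v u \<in> carrier_vec n" using w u by simp
      ultimately show "p \<in> (SIGMA v:carrier_vec n. ?S v)" unfolding p by (rule SigmaI[rotated])
    qed
    show "finite (SIGMA v:carrier_vec n. ?S v)" by (rule finite_SigmaI) auto
  qed
  also have "\<dots> = (\<Sum>v\<in>carrier_vec n. card (?S v))" by (rule card_SigmaI) auto
  also have "\<dots> \<le> (\<Sum>v\<in>(carrier_vec n :: 'a vec set). 2)" by (rule sum_mono) (rule S)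
  also have "\<dots> = 2 * card (UNIV :: 'a set) ^ n" by (simp add: card_carrier_vec)
  finally show ?thesis by (simp add: card_cartesian_product mult.commute)
qed

section \<open>Combination of the bounds\<close>

text \<open>Dividing by q - 1 with q/(q-1) <= 2 bounds the error by 2 Q above and 10 Q below. With r
  = q - 1, the constant 42 turns the two sides into Q <= 41 r Q and 5 Q <= 37 r Q.\<close>

lemma abs_diff_le_if_bounds:
  fixes N q Q :: nat
  assumes q: "q \<ge> 2" and up: "(q - 1) * N \<le> q * q * Q"
    and low: "q * (q - 1) * Q \<le> (q - 1) * N + 5 * q * Q"
  shows "\<bar>real N - real q * real Q\<bar> \<le> 42 * real Q"
proof -
  define r where "r = real q - 1"
  have r: "r \<ge> 1" and q_r: "real q = r + 1" and q1_r: "real (q - 1) = r" using q by (auto simp: r_def)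
  have up': "r * real N \<le> (r + 1) * (r + 1) * real Q"
    using of_nat_mono[OF up, where 'a = real] by (simp only: of_nat_mult q_r q1_r)
  have low': "(r + 1) * r * real Q \<le> r * real N + 5 * (r + 1) * real Q"
    using of_nat_mono[OF low, where 'a = real] by (simp only: of_nat_mult of_nat_add of_nat_numeral q_r q1_r)
  have "r * real N \<le> r * ((r + 1) * real Q + 42 * real Q)"
  proof -
    have "1 * real Q \<le> 41 * r * real Q" by (rule mult_right_mono) (use r in auto)
    then show ?thesis using up' by (simp add: algebra_simps)
  qed
  moreover have "r * ((r + 1) * real Q - 42 * real Q) \<le> r * real N"
  proof -
    have "5 * real Q \<le> 37 * r * real Q" by (rule mult_right_mono) (use r in auto)
    then show ?thesis using low' by (simp add: algebra_simps)
  qed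
  ultimately have "real N \<le> (r + 1) * real Q + 42 * real Q" "(r + 1) * real Q - 42 * real Q \<le> real N"
    using r by simp_all
  then show ?thesis unfolding q_r by (simp add: abs_le_iff)
qed

theorem theorem1p2:
  fixes X Y :: "'a :: {field, finite} mat set"
    and z :: "'a mat"
    and lam :: 'a
    and h :: "'a poly"
    and n q :: nat
  assumes q: "q = card (UNIV :: 'a set)"
    and n: "n \<ge> 2"
    and X: "is_conj_class n X"
    and X_irr: "irreducible (class_char_poly X)"
    and X_deg: "degree (class_char_poly X) = n"
    and Y: "is_conj_class n Y"
    and Y_char: "class_char_poly Y = [:- lam, 1:] * h"
    and h_irr: "irreducible h"
    and h_deg: "degree h = n - 1"
    and h_nz: "poly h lam \<noteq> 0"
    and z: "z \<in> carrier_mat n n"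
    and z_trace: "mat_trace z = class_trace X + class_trace Y"
  shows "(is_scalar_mat n z \<longrightarrow> num_reps X Y z = 0) \<and>
    (\<not> is_scalar_mat n z \<longrightarrow>
      \<bar>real (num_reps X Y z) - real q ^ ((n - 1)\<^sup>2)\<bar> \<le> 42 * real q ^ ((n - 1)\<^sup>2 - 1))"
proof -
  interpret linear_times_irreducible_class n lam h q
    by unfold_locales (use n h_irr h_nz q in auto)
  obtain x0 y0 where x0: "x0 \<in> X" and y0: "y0 \<in> Y" using conj_class_nonempty X Y by blast
  define f where "f = char_poly x0"
  have x0c: "x0 \<in> carrier_mat n n" "X = conj_class_of x0" using conj_class_memD[OF X x0] by auto
  have y0c: "y0 \<in> carrier_mat n n" "Y = conj_class_of y0" using conj_class_memD[OF Y y0] by auto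
  have f: "irreducible f" using X_irr class_char_poly_eq[OF X x0] by (simp add: f_def)
  have y0Y: "y0 \<in> Ys" using Y_char class_char_poly_eq[OF Y y0] y0c by (simp add: Ys_def)
  have X_iff: "x \<in> X \<longleftrightarrow> x \<in> carrier_mat n n \<and> char_poly x = f" for x
    using conj_class_memD(1)[OF X, of x] x0c similar_if_irreducible_char_poly[OF x0c(1), of x] n f
      char_poly_similar[of x x0] unfolding f_def conj_class_of_def by auto
  have Y_eq: "Y = Ys"
  proof (intro equalityI subsetI)
    fix y assume y: "y \<in> Y"
    then show "y \<in> Ys"
      using conj_class_memD(1)[OF Y y] class_char_poly_eq[OF Y y] Y_char by (simp add: Ys_def)
  next
    fix y assume "y \<in> Ys"
    then show "y \<in> Y" using Ys_similar[OF _ y0Y] y0c by (simp add: conj_class_of_def)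
  qed
  \<comment> \<open>A pair (x, y) with sum \<open>z\<close> is determined by y, and x = z - y lies
    in X as soon as its characteristic polynomial is the irreducible \<open>f\<close>.\<close>
  define S where "S = {y \<in> Ys. char_poly (z - y) = f}"
  have "bij_betw snd {(x, y). x \<in> X \<and> y \<in> Y \<and> x + y = z} S"
  proof (rule bij_betw_byWitness[where f' = "\<lambda>y. (z - y, y)"])
    have zy: "x = z - y" if "x \<in> carrier_mat n n" "y \<in> carrier_mat n n" "x + y = z" for x y
      using that by auto
    show "\<forall>p\<in>{(x, y). x \<in> X \<and> y \<in> Y \<and> x + y = z}. (z - snd p, snd p) = p"
      using zy Ys_carrier by (auto simp: X_iff Y_eq)
    show "snd ` {(x, y). x \<in> X \<and> y \<in> Y \<and> x + y = z} \<subseteq> S"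
      using zy Ys_carrier by (fastforce simp: X_iff Y_eq S_def)
    have "z - y \<in> carrier_mat n n" "z - y + y = z" if "y \<in> Ys" for y
      using z Ys_carrier[OF that] by (auto intro!: eq_matI)
    then show "(\<lambda>y. (z - y, y)) ` S \<subseteq> {(x, y). x \<in> X \<and> y \<in> Y \<and> x + y = z}"
      by (auto simp: X_iff Y_eq S_def)
  qed simp
  then have N: "num_reps X Y z = card S" unfolding num_reps_def by (rule bij_betw_same_card)
  define Nv where "Nv v = {y \<in> Yv v. char_poly (z - y) = f}" for v
  define V where "V = carrier_vec n - {0\<^sub>v n :: 'a vec}"
  have V: "finite V" "card V \<le> q ^ n"
    using card_Diff1_le[of "carrier_vec n :: 'a vec set" "0\<^sub>v n"]
    by (auto simp: V_def card_carrier_vec q)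
  have sumN: "(\<Sum>v\<in>V. card (Nv v)) = (q - 1) * card S"
  proof -
    have "Nv v = {y \<in> S. y *\<^sub>v v = lam \<cdot>\<^sub>v v}" for v by (auto simp: Nv_def Yv_def S_def)
    moreover have "S \<subseteq> Ys" by (auto simp: S_def)
    ultimately show ?thesis using sum_card_eigenvectors[of S] unfolding V_def by (simp only:)
  qed
  then have sumN': "(\<Sum>v\<in>V. q ^ n * card (Nv v)) = q ^ n * ((q - 1) * card S)"
    by (simp only: sum_distrib_left[symmetric])
  have sumY: "(\<Sum>v\<in>V. card (Yv v)) = (q - 1) * card Ys"
    using sum_card_eigenvectors[of Ys] unfolding V_def by (simp add: Yv_def)
  have q2: "q \<ge> 2" using card_field_ge_2[where 'a = 'a] by (simp add: q)
  define E where "E = {v \<in> carrier_vec n. \<exists>t. z *\<^sub>v v = t \<cdot>\<^sub>v v}"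
  have Nv_empty: "Nv v = {}" if "v \<in> V" "v \<in> E" for v
    using that Yv_sum_irreducible_empty[OF z _ _ _ f] unfolding E_def V_def Nv_def by blast
  \<comment> \<open>Since (n-1)^2 = n(n-2) + 1, the main term is q Q and the error is measured in
    units of \<open>Q\<close>.\<close>
  define Q where "Q = q ^ (n * (n - 2))"
  have qn: "q ^ n > 0" using q2 by simp
  have "n * (n - 1) = n + n * (n - 2)" using n by (cases n; cases "n - 1") auto
  then have power_Q: "(q ^ n) ^ (n - 1) = q ^ n * Q"
    by (simp only: Q_def power_mult[symmetric] power_add)
  have "card S = 0" if "is_scalar_mat n z"
  proof -
    obtain t where t: "z = t \<cdot>\<^sub>m 1\<^sub>m n" using \<open>is_scalar_mat n z\<close> by (auto simp: is_scalar_mat_def)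
    \<comment> \<open>Every nonzero vector is an eigenvector of a scalar \<open>z\<close>, so all
      the sets \<open>Nv v\<close> are empty.\<close>
    have "v \<in> E" if "v \<in> V" for v
      using that unfolding E_def V_def t by (auto intro!: exI[of _ t] eq_vecI)
    then have "(q - 1) * card S = 0" unfolding sumN[symmetric] using Nv_empty by simp
    then show ?thesis using q2 by simp
  qed
  moreover have "\<bar>real (card S) - real q * real Q\<bar> \<le> 42 * real Q" if ns: "\<not> is_scalar_mat n z"
  proof (rule abs_diff_le_if_bounds[OF q2])
    \<comment> \<open>At most q^n vectors v, each with q^n |Nv| <= q |Yv| <= q^2 Q.\<close>
    have "q ^ n * ((q - 1) * card S) \<le> (\<Sum>v\<in>V. q * (q * Q))"
      unfolding sumN'[symmetric]
    proof (rule sum_mono)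
      fix v assume "v \<in> V"
      then have v: "v \<in> carrier_vec n" "v \<noteq> 0\<^sub>v n" by (auto simp: V_def)
      show "q ^ n * card (Nv v) \<le> q * (q * Q)"
        using card_Yv_sum_irreducible_le[OF z v f] card_Yv_le[OF v] mult_le_mono2 le_trans
        unfolding Nv_def Q_def by blast
    qed
    also have "\<dots> \<le> q ^ n * (q * q * Q)" using V(2) by simp
    finally show "(q - 1) * card S \<le> q * q * Q" by (rule mult_left_le_imp_le[OF _ qn])
    \<comment> \<open>The loss at a single v: all of \<open>Yv v\<close> if v is an eigenvector of
      \<open>z\<close>, and otherwise only the y for which v is not cyclic.\<close>
    have each: "q * card (Yv v) \<le> q ^ n * card (Nv v) + 2 * q * Q + (if v \<in> E then q * (q * Q) else 0)"
      if "v \<in> V" for v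
    proof (cases "v \<in> E")
      case True
      have "q * card (Yv v) \<le> q * (q * Q)"
        unfolding Q_def by (rule mult_le_mono2, rule card_Yv_le) (use that in \<open>auto simp: V_def\<close>)
      then show ?thesis unfolding if_P[OF True] by linarith
    next
      case False
      have v: "v \<in> carrier_vec n" "v \<noteq> 0\<^sub>v n" "\<And>t. z *\<^sub>v v \<noteq> t \<cdot>\<^sub>v v"
        using that False by (auto simp: V_def E_def)
      let ?C = "{y \<in> Yv v. cyclic_vec (z - y) v}" and ?D = "{y \<in> Yv v. \<not> cyclic_vec (z - y) v}"
      have "card (Yv v) = card (?C \<union> ?D)" by (rule arg_cong[of _ _ card]) auto
      also have "\<dots> = card ?C + card ?D" by (rule card_Un_disjoint) auto
      finally have split: "card (Yv v) = card ?C + card ?D" .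
      have C: "q * card ?C \<le> q ^ n * card (Nv v)"
        unfolding Nv_def f_def
      proof (rule card_Yv_cyclic_le[OF z v(1,2) x0c(1)])
        show "irreducible (char_poly x0)" using f by (simp add: f_def)
        show "mat_trace z = mat_trace x0 + mat_trace y" if "y \<in> Ys" for y
          using z_trace class_trace_eq[OF X x0] class_trace_eq[OF Y, of y] that by (simp add: Y_eq)
      qed
      have "(q - 1) * card ?D \<le> q * Q"
        unfolding Q_def by (rule card_Yv_not_cyclic_le[OF z v])
      \<comment> \<open>Here q <= 2 (q - 1), because q >= 2.\<close>
      also have "\<dots> \<le> (q - 1) * (2 * Q)" using q2 by (cases q) auto
      finally have "card ?D \<le> 2 * Q" using q2 by simp
      from mult_le_mono2[OF this, of q] have "q * card ?D \<le> 2 * q * Q" by (simp only: mult_ac)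
      then show ?thesis using C unfolding split distrib_left if_not_P[OF False] by linarith
    qed
    \<comment> \<open>In units of q^n q Q the losses are 1 from the size of \<open>Ys\<close>, 2
      from the y for which v is not cyclic, and 2 from eigenvectors of \<open>z\<close>, which makes
      the 5 below.\<close>
    have "q ^ n * (q * (q - 1) * Q) = q * ((q - 1) * (q ^ n) ^ (n - 1))"
      by (simp only: power_Q mult_ac)
    also have "\<dots> \<le> q * ((q - 1) * card Ys + (q ^ n) ^ (n - 1))"
      by (rule mult_le_mono2[OF card_Ys_ge[OF y0Y]])
    also have "\<dots> = (\<Sum>v\<in>V. q * card (Yv v)) + q * (q ^ n) ^ (n - 1)"
      by (simp only: sumY[symmetric] sum_distrib_left distrib_left)
    also have "(\<Sum>v\<in>V. q * card (Yv v))
        \<le> (\<Sum>v\<in>V. q ^ n * card (Nv v) + 2 * q * Q + (if v \<in> E then q * (q * Q) else 0))"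
      by (rule sum_mono) (rule each)
    also have "\<dots> = q ^ n * ((q - 1) * card S) + card V * (2 * q * Q) + card (V \<inter> E) * (q * (q * Q))"
      using V(1) by (simp add: sum.distrib sumN' sum.If_cases Int_def)
    also have "card V * (2 * q * Q) \<le> q ^ n * (2 * q * Q)" using V(2) by simp
    also have "card (V \<inter> E) * (q * (q * Q)) \<le> card E * (q * (q * Q))"
      by (intro mult_le_mono1 card_mono) (auto simp: E_def)
    also have "card E * (q * (q * Q)) = (q * card E) * (q * Q)" by (simp only: mult_ac)
    also have "\<dots> \<le> (2 * q ^ n) * (q * Q)"
      unfolding E_def q by (intro mult_le_mono1 card_eigenvectors_le[OF z _ ns]) (use n in simp)
    also have "q * (q ^ n) ^ (n - 1) = q ^ n * (q * Q)"
      by (simp only: power_Q mult_ac)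
    finally have "q ^ n * (q * (q - 1) * Q) \<le> q ^ n * ((q - 1) * card S + 5 * q * Q)"
      by (simp add: algebra_simps)
    then show "q * (q - 1) * Q \<le> (q - 1) * card S + 5 * q * Q" by (rule mult_left_le_imp_le[OF _ qn])
  qed
  moreover have "(n - 1)\<^sup>2 = Suc (n * (n - 2))"
    using n by (cases n; cases "n - 1") (auto simp: power2_eq_square)
  ultimately show ?thesis by (simp add: N Q_def)
qed

end
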